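(* (Local-to-Global Principle.) Let $X$ be a normal, first countable, arcwise connected, Hausdorff topological space and let $(Y,d)$ be a complete, locally compact length space. Assume that $f:X\to Y$ is a continuous closed map that is locally open onto its image, locally fiber connected, and has local convexity data. Then: (i) $f(X)$ is a weakly convex subset of $(Y,d)$. (ii) If, in addition, $(Y,d)$ is uniquely geodesic (that is, any two points of $Y$ can be joined by a unique geodesic) and $d(y_1,y_2)<\infty$ for all $y_1,y_2\in Y$, then $f(X)$ is a convex subset of $(Y,d)$, $f$ has connected fibers, and $f$ is open onto its image (that is, $f:X\to f(X)$ is an open map, with $f(X)$ carrying the topology induced from $Y$).
   Context: Metric notions. A metric on a set $Z$ is a function $d:Z\times Z\to\mathbb{R}\cup\{\infty\}$ (the value $\infty$ is allowed) that is positive off the diagonal, zero on the diagonal, symmetric, and satisfies the triangle inequality. The length of a curve (continuous map) $c:[a,b]\to Z$ is $l_d(c)=\sup\sum_i d(c(t_i),c(t_{i+1}))$ over all partitions $a=t_0\le\dots\le t_n=b$; $c$ is rectifiable if $l_d(c)<\infty$. The metric $d$ is a length metric, and $(Z,d)$ a length space, if for all $x,y$ the number $d(x,y)$ is the infimum of the lengths of rectifiable curves joining $x$ and $y$ (with $d(x,y)=\infty$ if there are none). A curve is a shortest path if its length is minimal among all curves with the same endpoints. In a length space a curve $c:I\to Z$ ($I\subset\mathbb{R}$ an interval) is a geodesic if every $t\in I$ has a subinterval $J$ of $I$, containing a neighborhood of $t$ in $I$, such that $c|_J$ is a shortest path (geodesics are thus only locally shortest). A length space is a geodesic metric space if any two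 points are joined by a shortest path; by the Hopf-Rinow-Cohn-Vossen theorem a complete locally compact length space is a geodesic metric space. Uniqueness of geodesics is understood up to reparametrization. A subset $C$ of a metric space $(Z,d)$ is convex if the restriction of $d$ to $C$ is a length metric on $C$ taking only finite values. A subset $C$ of a geodesic metric space is weakly convex if any two points of $C$ can be joined by a geodesic of $(Z,d)$ (not necessarily a shortest path) entirely contained in $C$. Local conditions. Let $f:X\to Y$ be continuous. A subset $A\subset X$ satisfies (LFC) if for every $x\in A$ the set $A$ does not intersect two different connected components of the fiber $f^{-1}(f(x))$. The map $f$ is locally fiber connected if for each $x\in X$ any open neighborhood of $x$ contains a connected neighborhood of $x$ satisfying (LFC). The map $f$ is locally open onto its image if every $x\in X$ has an open neighborhood $U_x$ such that $f|_{U_x}:U_x\to f(U_x)$ is open, where $f(U_x)$ has the topology induced by $Y$. The map $f$ has local convexity data if each $x\in X$ has arbitrarily small neighborhoods $U_x$ (i.e. every neighborhood of $x$ contains such a neighborhood) for which $f(U_x)$ is a convex subset of $Y$. *)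

theory Defs
  imports "HOL-Analysis.Analysis"
begin

section \<open>Metrics with values in \<open>[0, \<infinity>]\<close>\<close>

locale ext_metric =
  fixes M :: "'b set" and d :: "'b \<Rightarrow> 'b \<Rightarrow> ennreal"
  assumes zero: "\<And>x y. \<lbrakk>x \<in> M; y \<in> M\<rbrakk> \<Longrightarrow> d x y = 0 \<longleftrightarrow> x = y"
    and commute: "\<And>x y. \<lbrakk>x \<in> M; y \<in> M\<rbrakk> \<Longrightarrow> d x y = d y x"
    and triangle: "\<And>x y z. \<lbrakk>x \<in> M; y \<in> M; z \<in> M\<rbrakk> \<Longrightarrow> d x z \<le> d x y + d y z"

definition ext_mtopology :: "'b set \<Rightarrow> ('b \<Rightarrow> 'b \<Rightarrow> ennreal) \<Rightarrow> 'b topology" where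
  "ext_mtopology M d =
     topology (\<lambda>U. U \<subseteq> M \<and> (\<forall>x\<in>U. \<exists>r>0. {y \<in> M. d x y < r} \<subseteq> U))"

lemma openin_ext_mtopology:
  "openin (ext_mtopology M d) U \<longleftrightarrow>
     U \<subseteq> M \<and> (\<forall>x\<in>U. \<exists>r>0. {y \<in> M. d x y < r} \<subseteq> U)"
proof -
  let ?P = "\<lambda>U. U \<subseteq> M \<and> (\<forall>x\<in>U. \<exists>r>0. {y \<in> M. d x y < r} \<subseteq> U)"
  have int: "?P (S \<inter> T)" if S: "?P S" and T: "?P T" for S T
  proof (intro conjI ballI)
    show "S \<inter> T \<subseteq> M" using S by blast
    fix x assume x: "x \<in> S \<inter> T"
    obtain r where r: "r > 0" "{y \<in> M. d x y < r} \<subseteq> S" using S x by blast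
    obtain s where s: "s > 0" "{y \<in> M. d x y < s} \<subseteq> T" using T x by blast
    show "\<exists>r>0. {y \<in> M. d x y < r} \<subseteq> S \<inter> T"
      using r s by (intro exI[of _ "min r s"]) auto
  qed
  have un: "?P (\<Union>K)" if K: "\<forall>S\<in>K. ?P S" for K
  proof (intro conjI ballI)
    show "\<Union>K \<subseteq> M" using K by blast
    fix x assume "x \<in> \<Union>K"
    then obtain S where "S \<in> K" "x \<in> S" by blast
    then obtain r where "r > 0" "{y \<in> M. d x y < r} \<subseteq> S" using K by blast
    then show "\<exists>r>0. {y \<in> M. d x y < r} \<subseteq> \<Union>K" using \<open>S \<in> K\<close> by blast
  qed
  have "istopology ?P"
    unfolding istopology_def using int un by blast
  then show ?thesis
    unfolding ext_mtopology_def by (simp add: topology_inverse')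
qed

lemma topspace_ext_mtopology [simp]: "topspace (ext_mtopology M d) = M"
proof -
  have "openin (ext_mtopology M d) M"
    unfolding openin_ext_mtopology by (auto intro: exI[of _ 1])
  then show ?thesis
    using openin_subset openin_topspace openin_ext_mtopology by (metis subset_antisym)
qed

definition ext_mcomplete :: "'b set \<Rightarrow> ('b \<Rightarrow> 'b \<Rightarrow> ennreal) \<Rightarrow> bool" where
  "ext_mcomplete M d \<longleftrightarrow>
     (\<forall>s::nat \<Rightarrow> 'b. range s \<subseteq> M \<and> (\<forall>e>0. \<exists>N. \<forall>m\<ge>N. \<forall>n\<ge>N. d (s m) (s n) < e)
        \<longrightarrow> (\<exists>l. limitin (ext_mtopology M d) s l sequentially))"

section \<open>Curves, length, length spaces\<close>

definition curve :: "'b set \<Rightarrow> ('b \<Rightarrow> 'b \<Rightarrow> ennreal) \<Rightarrow> real \<Rightarrow> real \<Rightarrow> (real \<Rightarrow> 'b) \<Rightarrow> bool" where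
  "curve M d a b c \<longleftrightarrow>
     a \<le> b \<and> continuous_map (top_of_set {a..b}) (ext_mtopology M d) c"

definition curve_length :: "('b \<Rightarrow> 'b \<Rightarrow> ennreal) \<Rightarrow> real \<Rightarrow> real \<Rightarrow> (real \<Rightarrow> 'b) \<Rightarrow> ennreal" where
  "curve_length d a b c =
     (SUP (n, t) \<in> {(n::nat, t::nat \<Rightarrow> real). t 0 = a \<and> t n = b \<and> (\<forall>i<n. t i \<le> t (Suc i))}.
        \<Sum>i<n. d (c (t i)) (c (t (Suc i))))"

text \<open>In \<^typ>\<open>ennreal\<close> the infimum of the empty set is \<open>\<infinity>\<close>, so points that are not joined by a
  rectifiable curve are required to be at distance \<open>\<infinity>\<close>.\<close>

definition length_metric :: "'b set \<Rightarrow> ('b \<Rightarrow> 'b \<Rightarrow> ennreal) \<Rightarrow> bool" where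
  "length_metric M d \<longleftrightarrow>
     (\<forall>x\<in>M. \<forall>y\<in>M. d x y =
        (INF (a, b, c) \<in> {(a, b, c). curve M d a b c \<and> c a = x \<and> c b = y \<and> curve_length d a b c < \<infinity>}.
           curve_length d a b c))"

definition length_space :: "'b set \<Rightarrow> ('b \<Rightarrow> 'b \<Rightarrow> ennreal) \<Rightarrow> bool" where
  "length_space M d \<longleftrightarrow> ext_metric M d \<and> length_metric M d"

definition metric_convex :: "'b set \<Rightarrow> ('b \<Rightarrow> 'b \<Rightarrow> ennreal) \<Rightarrow> 'b set \<Rightarrow> bool" where
  "metric_convex M d C \<longleftrightarrow>
     C \<subseteq> M \<and> length_metric C d \<and> (\<forall>x\<in>C. \<forall>y\<in>C. d x y < \<infinity>)"

section \<open>Geodesics\<close>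

definition shortest_path :: "'b set \<Rightarrow> ('b \<Rightarrow> 'b \<Rightarrow> ennreal) \<Rightarrow> real \<Rightarrow> real \<Rightarrow> (real \<Rightarrow> 'b) \<Rightarrow> bool" where
  "shortest_path M d a b c \<longleftrightarrow>
     curve M d a b c \<and>
     (\<forall>a' b' c'. curve M d a' b' c' \<and> c' a' = c a \<and> c' b' = c b
        \<longrightarrow> curve_length d a b c \<le> curve_length d a' b' c')"

text \<open>The last conjunct is the usual convention that a geodesic does not pause: it is not constant
  on any nondegenerate subinterval.  Every rectifiable curve can be so reparametrized.
  Without it, any concatenation of shortest paths that rests for a while at each
  corner would be locally shortest at every parameter value, and geodesics would never be unique up
  to reparametrization.  Degenerate intervals are allowed, so a point is joined to itself by a
  trivial geodesic.\<close>

definition geodesic :: "'b set \<Rightarrow> ('b \<Rightarrow> 'b \<Rightarrow> ennreal) \<Rightarrow> real set \<Rightarrow> (real \<Rightarrow> 'b) \<Rightarrow> bool" where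
  "geodesic M d I c \<longleftrightarrow>
     is_interval I \<and> continuous_map (top_of_set I) (ext_mtopology M d) c \<and>
     (\<forall>t\<in>I. \<exists>u v. {u..v} \<subseteq> I \<and> (\<exists>e>0. I \<inter> {t - e<..<t + e} \<subseteq> {u..v}) \<and> shortest_path M d u v c) \<and>
     (\<forall>u\<in>I. \<forall>v\<in>I. u < v \<longrightarrow> \<not> c constant_on {u..v})"

definition geodesic_joining ::
  "'b set \<Rightarrow> ('b \<Rightarrow> 'b \<Rightarrow> ennreal) \<Rightarrow> 'b \<Rightarrow> 'b \<Rightarrow> real \<Rightarrow> real \<Rightarrow> (real \<Rightarrow> 'b) \<Rightarrow> bool" where
  "geodesic_joining M d x y a b c \<longleftrightarrow> a \<le> b \<and> geodesic M d {a..b} c \<and> c a = x \<and> c b = y"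

definition reparametrization ::
  "real \<Rightarrow> real \<Rightarrow> (real \<Rightarrow> 'b) \<Rightarrow> real \<Rightarrow> real \<Rightarrow> (real \<Rightarrow> 'b) \<Rightarrow> bool" where
  "reparametrization a b c a' b' c' \<longleftrightarrow>
     (\<exists>p. continuous_on {a..b} p \<and> strict_mono_on {a..b} p \<and> p ` {a..b} = {a'..b'} \<and>
          (\<forall>t\<in>{a..b}. c t = c' (p t)))"

definition uniquely_geodesic :: "'b set \<Rightarrow> ('b \<Rightarrow> 'b \<Rightarrow> ennreal) \<Rightarrow> bool" where
  "uniquely_geodesic M d \<longleftrightarrow>
     (\<forall>x\<in>M. \<forall>y\<in>M. (\<exists>a b c. geodesic_joining M d x y a b c) \<and>
        (\<forall>a b c a' b' c'. geodesic_joining M d x y a b c \<and> geodesic_joining M d x y a' b' c'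
           \<longrightarrow> reparametrization a b c a' b' c'))"

definition weakly_convex :: "'b set \<Rightarrow> ('b \<Rightarrow> 'b \<Rightarrow> ennreal) \<Rightarrow> 'b set \<Rightarrow> bool" where
  "weakly_convex M d C \<longleftrightarrow>
     C \<subseteq> M \<and>
     (\<forall>x\<in>C. \<forall>y\<in>C. \<exists>a b c. geodesic_joining M d x y a b c \<and> c ` {a..b} \<subseteq> C)"

section \<open>Local conditions on a map\<close>

definition fiber :: "'a topology \<Rightarrow> ('a \<Rightarrow> 'b) \<Rightarrow> 'b \<Rightarrow> 'a set" where
  "fiber X f y = {x \<in> topspace X. f x = y}"

definition LFC :: "'a topology \<Rightarrow> ('a \<Rightarrow> 'b) \<Rightarrow> 'a set \<Rightarrow> bool" where
  "LFC X f A \<longleftrightarrow>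
     (\<forall>x\<in>A. \<forall>E\<in>connected_components_of (subtopology X (fiber X f (f x))).
        \<forall>E'\<in>connected_components_of (subtopology X (fiber X f (f x))).
          A \<inter> E \<noteq> {} \<and> A \<inter> E' \<noteq> {} \<longrightarrow> E = E')"

definition locally_fiber_connected :: "'a topology \<Rightarrow> ('a \<Rightarrow> 'b) \<Rightarrow> bool" where
  "locally_fiber_connected X f \<longleftrightarrow>
     neighbourhood_base_of (\<lambda>V. connectedin X V \<and> LFC X f V) X"

definition locally_open_onto_image :: "'a topology \<Rightarrow> 'b topology \<Rightarrow> ('a \<Rightarrow> 'b) \<Rightarrow> bool" where
  "locally_open_onto_image X Y f \<longleftrightarrow>
     (\<forall>x\<in>topspace X. \<exists>U. openin X U \<and> x \<in> U \<and>
        open_map (subtopology X U) (subtopology Y (f ` U)) f)"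

definition local_convexity_data ::
  "'a topology \<Rightarrow> 'b set \<Rightarrow> ('b \<Rightarrow> 'b \<Rightarrow> ennreal) \<Rightarrow> ('a \<Rightarrow> 'b) \<Rightarrow> bool" where
  "local_convexity_data X M d f \<longleftrightarrow>
     neighbourhood_base_of (\<lambda>U. metric_convex M d (f ` U)) X"

end

(* Identify points of X that lie in the same component of a fibre of f.  Closedness of f and
   normality of X make every point of the quotient have a neighbourhood that f maps homeomorphically
   onto a ball of a convex set and that is clopen in the preimage of the ambient ball.  Measuring
   chains of small steps by the lengths of their images yields a metric rho on the quotient, for which
   f is locally isometric.  Closedness of f transports completeness and local compactness from Y to
   rho, so Hopf-Rinow provides rho-shortest paths, and f maps these to geodesics of Y inside f(X).
   If geodesics of Y are unique, then comparing the image of a rho-shortest path with a shortest path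
   of Y gives rho(x, y) = d(f x, f y).  This makes f(X) convex, and two points of one fibre have
   rho-distance 0, hence lie in the same component of it. *)
theory Submission
  imports Defs
begin

section \<open>The Hopf--Rinow theorem for pseudometrics\<close>

text \<open>Passing to classes would require a quotient topology and its separation properties.
  Keeping the points of \<open>X\<close> and letting \<open>rho\<close> vanish on fibre components
  avoids this, at the price of a Hopf-Rinow theorem for pseudometrics.

  The main obstacle is that fibres need not be compact. Closedness of \<open>f\<close> says nothing
  about a sequence inside a single fibre, so convergence of values does not lift directly to
  \<open>X\<close>: for local compactness the limit is caught in a closed piece of one chart, and
  for completeness the sequence has to be moved off the limiting fibre.

  Infinite distances disappear at the start: \<open>f(X)\<close> is connected, so its distances are
  finite, and it is closed in \<open>Y\<close>, so it is itself complete and locally compact. It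
  need not be a length space, which is why Hopf-Rinow is applied to \<open>rho\<close> and not to
  \<open>d\<close> on \<open>f(X)\<close>.

  The comparison in (ii) needs no lengths of arbitrary curves: both paths have unit speed, so a
  reparametrization of one into the other must be the identity.\<close>

locale pseudo_metric =
  fixes P :: "'a set" and \<rho> :: "'a \<Rightarrow> 'a \<Rightarrow> real"
  assumes refl: "x \<in> P \<Longrightarrow> \<rho> x x = 0"
    and sym: "\<lbrakk>x \<in> P; y \<in> P\<rbrakk> \<Longrightarrow> \<rho> x y = \<rho> y x"
    and tri: "\<lbrakk>x \<in> P; y \<in> P; z \<in> P\<rbrakk> \<Longrightarrow> \<rho> x z \<le> \<rho> x y + \<rho> y z"
begin

lemma nonneg: "\<lbrakk>x \<in> P; y \<in> P\<rbrakk> \<Longrightarrow> 0 \<le> \<rho> x y"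
  using tri[of x y x] sym[of x y] refl[of x] by simp

lemma tendsto_dist:
  assumes "x \<in> P" "z \<in> P" "range u \<subseteq> P" and lim: "(\<lambda>n. \<rho> (u n) x) \<longlonglongrightarrow> 0"
  shows "(\<lambda>n. \<rho> (u n) z) \<longlonglongrightarrow> \<rho> x z"
proof -
  have "\<bar>\<rho> (u n) z - \<rho> x z\<bar> \<le> \<rho> (u n) x" for n
    using tri[of "u n" x z] tri[of x "u n" z] sym[of x "u n"] assms by fastforce
  then have "(\<lambda>n. \<rho> (u n) z - \<rho> x z) \<longlonglongrightarrow> 0"
    by (intro Lim_null_comparison[OF _ lim]) auto
  then show ?thesis
    by (simp add: LIM_zero_iff)
qed

definition complete :: bool where
  "complete \<longleftrightarrow> (\<forall>u::nat \<Rightarrow> 'a. range u \<subseteq> P \<and> (\<forall>e>0. \<exists>N. \<forall>m\<ge>N. \<forall>n\<ge>N. \<rho> (u m) (u n) < e)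
      \<longrightarrow> (\<exists>x\<in>P. (\<lambda>n. \<rho> (u n) x) \<longlonglongrightarrow> 0))"

text \<open>The limit may lie outside the ball, so this is relative compactness of small
  balls.\<close>

definition locally_seq_compact :: bool where
  "locally_seq_compact \<longleftrightarrow> (\<forall>p\<in>P. \<exists>r>0. \<forall>u::nat \<Rightarrow> 'a. range u \<subseteq> {x \<in> P. \<rho> p x < r}
      \<longrightarrow> (\<exists>x\<in>P. \<exists>k. strict_mono k \<and> (\<lambda>n. \<rho> (u (k n)) x) \<longlonglongrightarrow> 0))"

definition approx_between :: bool where
  "approx_between \<longleftrightarrow> (\<forall>x\<in>P. \<forall>y\<in>P. \<forall>s\<in>{0..\<rho> x y}. \<forall>\<delta>>0. \<exists>u\<in>P. \<rho> x u \<le> s \<and> \<rho> u y \<le> \<rho> x y - s + \<delta>)"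

text \<open>For \<open>s < r\<close> the approximate intermediate points stay in a relatively
  compact ball; the limit of a subsequence loses the error, and the triangle inequality turns the
  two upper bounds into equalities.\<close>

lemma exact_between:
  assumes "locally_seq_compact" "approx_between" and x: "x \<in> P"
  obtains r where "r > 0"
    "\<And>y s. \<lbrakk>y \<in> P; 0 \<le> s; s \<le> \<rho> x y; s < r\<rbrakk> \<Longrightarrow> \<exists>u\<in>P. \<rho> x u = s \<and> \<rho> u y = \<rho> x y - s"
proof -
  obtain r where r: "r > 0" and cpt: "\<And>u::nat \<Rightarrow> 'a. range u \<subseteq> {z \<in> P. \<rho> x z < r}
      \<Longrightarrow> \<exists>z\<in>P. \<exists>k. strict_mono k \<and> (\<lambda>n. \<rho> (u (k n)) z) \<longlonglongrightarrow> 0"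
    using assms(1) x unfolding locally_seq_compact_def by blast
  have "\<exists>u\<in>P. \<rho> x u = s \<and> \<rho> u y = \<rho> x y - s"
    if y: "y \<in> P" and s: "0 \<le> s" "s \<le> \<rho> x y" "s < r" for y s
  proof -
    have "\<exists>u\<in>P. \<rho> x u \<le> s \<and> \<rho> u y \<le> \<rho> x y - s + inverse (real (Suc n))" for n
      using assms(2) x y s unfolding approx_between_def by simp
    then obtain u where u: "\<And>n. u n \<in> P" "\<And>n. \<rho> x (u n) \<le> s"
      "\<And>n. \<rho> (u n) y \<le> \<rho> x y - s + inverse (real (Suc n))"
      by metis
    have "range u \<subseteq> {z \<in> P. \<rho> x z < r}"
      using u s by (auto intro: le_less_trans)
    then obtain z k where z: "z \<in> P" and k: "strict_mono k" "(\<lambda>n. \<rho> (u (k n)) z) \<longlonglongrightarrow> 0"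
      using cpt by blast
    have "(\<lambda>n. \<rho> (u (k n)) x) \<longlonglongrightarrow> \<rho> z x"
      using tendsto_dist[of z x "\<lambda>n. u (k n)"] z x u k by auto
    then have 1: "\<rho> z x \<le> s"
      using u sym[OF x] by (intro LIMSEQ_le_const2) auto
    have "(\<lambda>n. \<rho> (u (k n)) y) \<longlonglongrightarrow> \<rho> z y"
      using tendsto_dist[of z y "\<lambda>n. u (k n)"] z y u k by auto
    moreover have "(\<lambda>n. \<rho> x y - s + inverse (real (Suc (k n)))) \<longlonglongrightarrow> \<rho> x y - s + 0"
      using LIMSEQ_subseq_LIMSEQ[OF LIMSEQ_inverse_real_of_nat k(1)]
      by (intro tendsto_intros) (auto simp: o_def)
    ultimately have "\<rho> z y \<le> \<rho> x y - s + 0"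
      by (rule LIMSEQ_le) (use u in auto)
    then show ?thesis
      using 1 z tri[of x z y] x y sym[of x z] by (intro bexI[of _ z]) auto
  qed
  with r show ?thesis
    using that by blast
qed

text \<open>A maximal set \<open>C\<close> between \<open>x\<close> and \<open>y\<close> on which
  \<open>\<rho> x\<close> is isometric has a closed image in \<open>[0, \<rho> x y]\<close>, by completeness, and this
  image has no gaps, because a gap could be entered from its left end by local compactness.\<close>

theorem Hopf_Rinow:
  assumes compl: "complete" and "locally_seq_compact" "approx_between" and x: "x \<in> P" and y: "y \<in> P"
  obtains \<gamma> where "\<gamma> ` {0..\<rho> x y} \<subseteq> P" "\<rho> (\<gamma> 0) x = 0" "\<rho> (\<gamma> (\<rho> x y)) y = 0"
    "\<And>s t. \<lbrakk>s \<in> {0..\<rho> x y}; t \<in> {0..\<rho> x y}\<rbrakk> \<Longrightarrow> \<rho> (\<gamma> s) (\<gamma> t) = \<bar>s - t\<bar>"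
proof -
  define L where "L = \<rho> x y"
  have L0: "0 \<le> L" using nonneg x y by (simp add: L_def)
  define \<C> where "\<C> = {C. C \<subseteq> P \<and> x \<in> C \<and> y \<in> C \<and>
     (\<forall>z\<in>C. \<rho> x z \<le> L) \<and> (\<forall>z\<in>C. \<forall>w\<in>C. \<rho> z w = \<bar>\<rho> x z - \<rho> x w\<bar>)}"
  have "{x, y} \<in> \<C>"
    using x y refl sym L0 nonneg by (auto simp: \<C>_def L_def)
  moreover have "\<Union>\<K> \<in> \<C>" if "\<K> \<noteq> {}" "subset.chain \<C> \<K>" for \<K>
  proof -
    have sub: "\<K> \<subseteq> \<C>" and ch: "\<And>A B. A \<in> \<K> \<Longrightarrow> B \<in> \<K> \<Longrightarrow> A \<subseteq> B \<or> B \<subseteq> A"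
      using that by (auto simp: subset.chain_def)
    have "\<rho> z w = \<bar>\<rho> x z - \<rho> x w\<bar>" if "A \<in> \<K>" "B \<in> \<K>" "z \<in> A" "w \<in> B" for A B z w
      using ch[OF that(1,2)] that sub unfolding \<C>_def by blast
    moreover have "\<Union>\<K> \<subseteq> P" "\<forall>z\<in>\<Union>\<K>. \<rho> x z \<le> L" "x \<in> \<Union>\<K>" "y \<in> \<Union>\<K>"
      using sub \<open>\<K> \<noteq> {}\<close> unfolding \<C>_def by blast+
    ultimately show ?thesis
      unfolding \<C>_def by blast
  qed
  ultimately obtain C where C: "C \<in> \<C>" and max: "\<And>B. B \<in> \<C> \<Longrightarrow> C \<subseteq> B \<Longrightarrow> B = C"
    using subset_Zorn_nonempty[of \<C>] by blast
  have CP: "C \<subseteq> P" and xC: "x \<in> C" and yC: "y \<in> C" and CL: "\<And>z. z \<in> C \<Longrightarrow> \<rho> x z \<le> L"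
    and iso: "\<And>z w. z \<in> C \<Longrightarrow> w \<in> C \<Longrightarrow> \<rho> z w = \<bar>\<rho> x z - \<rho> x w\<bar>"
    using C unfolding \<C>_def by blast+
  \<comment> \<open>By maximality, a point whose distances to all of \<open>C\<close> fit the
    coordinate \<open>\<rho> x\<close> already belongs to \<open>C\<close>.\<close>
  have insertI: "u \<in> C" if u: "u \<in> P" and "\<And>z. z \<in> C \<Longrightarrow> \<rho> u z = \<bar>\<rho> x u - \<rho> x z\<bar>" "\<rho> x u \<le> L" for u
  proof -
    note assms = that
    have "\<rho> z u = \<bar>\<rho> x z - \<rho> x u\<bar>" if "z \<in> C" for z
      using that sym[OF u, of z] CP assms(2)[OF that] by auto
    then have "\<rho> z w = \<bar>\<rho> x z - \<rho> x w\<bar>" if "z \<in> insert u C" "w \<in> insert u C" for z w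
      using that iso[of z w] assms(2)[of w] refl[OF u] by (cases "z = u"; cases "w = u") auto
    then have "insert u C \<in> \<C>"
      unfolding \<C>_def using u CP xC yC CL assms(3) by blast
    then show ?thesis using max by blast
  qed
  have closed: "closed (\<rho> x ` C)"
    unfolding closed_sequential_limits
  proof safe
    fix v :: "nat \<Rightarrow> real" and l assume v: "\<forall>n. v n \<in> \<rho> x ` C" and l: "v \<longlonglongrightarrow> l"
    have "\<exists>z. z \<in> C \<and> v n = \<rho> x z" for n
      using spec[OF v, of n] by (elim imageE) blast
    then obtain z where z: "\<And>n. z n \<in> C" "\<And>n. v n = \<rho> x (z n)"
      by metis
    have zP: "range z \<subseteq> P" using z CP by auto
    have "Cauchy v" using l by (rule LIMSEQ_imp_Cauchy)
    then have "\<forall>e>0. \<exists>N. \<forall>m\<ge>N. \<forall>n\<ge>N. \<rho> (z m) (z n) < e"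
      unfolding Cauchy_def dist_real_def using iso[OF z(1) z(1)] z(2) by simp
    then obtain w where w: "w \<in> P" and lim: "(\<lambda>n. \<rho> (z n) w) \<longlonglongrightarrow> 0"
      using compl zP unfolding complete_def by blast
    have "(\<lambda>n. \<rho> (z n) x) \<longlonglongrightarrow> \<rho> w x"
      using w x zP lim by (rule tendsto_dist)
    moreover have "v = (\<lambda>n. \<rho> (z n) x)"
    proof
      show "v n = \<rho> (z n) x" for n
        using z(2)[of n] sym[OF x, of "z n"] zP by auto
    qed
    ultimately have "v \<longlonglongrightarrow> \<rho> x w"
      using sym[OF x w] by simp
    then have lw: "l = \<rho> x w"
      using l LIMSEQ_unique by blast
    have "w \<in> C"
    proof (rule insertI[OF w])
      show "\<rho> x w \<le> L"
        using l lw z CL by (intro LIMSEQ_le_const2[OF l[unfolded lw]]) auto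
      fix u assume u: "u \<in> C"
      have "(\<lambda>n. \<rho> (z n) u) \<longlonglongrightarrow> \<rho> w u"
        using w u CP zP lim by (intro tendsto_dist) auto
      moreover have "(\<lambda>n. \<bar>v n - \<rho> x u\<bar>) \<longlonglongrightarrow> \<bar>l - \<rho> x u\<bar>"
        by (intro tendsto_intros l)
      ultimately show "\<rho> w u = \<bar>\<rho> x w - \<rho> x u\<bar>"
        using iso[OF z(1) u] z(2) lw LIMSEQ_unique by auto
    qed
    then show "l \<in> \<rho> x ` C" using lw by blast
  qed
  have img: "s \<in> \<rho> x ` C" if s: "0 \<le> s" "s \<le> L" for s
  proof (rule ccontr)
    assume ns: "s \<notin> \<rho> x ` C"
    define A where "A = \<rho> x ` C \<inter> {..s}"
    define B where "B = \<rho> x ` C \<inter> {s..}"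
    have "\<rho> x x \<in> A" using xC s refl[OF x] by (auto simp: A_def)
    moreover have bA: "bdd_above A" by (auto simp: A_def)
    moreover have "closed A" unfolding A_def using closed by auto
    ultimately have "Sup A \<in> A" using closed_contains_Sup by blast
    then obtain z where z: "z \<in> C" "\<rho> x z \<le> s" "Sup A = \<rho> x z" by (auto simp: A_def)
    have "\<rho> x y \<in> B" using yC s by (auto simp: B_def L_def)
    moreover have bB: "bdd_below B" by (auto simp: B_def)
    moreover have "closed B" unfolding B_def using closed by auto
    ultimately have "Inf B \<in> B" using closed_contains_Inf by blast
    then obtain w where w: "w \<in> C" "\<rho> x w \<ge> s" "Inf B = \<rho> x w" by (auto simp: B_def)
    have gap: "\<rho> x v \<le> \<rho> x z \<or> \<rho> x w \<le> \<rho> x v" if "v \<in> C" for v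
    proof (cases "\<rho> x v \<le> s")
      case True then have "\<rho> x v \<in> A" using that by (auto simp: A_def)
      then show ?thesis using cSup_upper[OF _ bA] z by auto
    next
      case False then have "\<rho> x v \<in> B" using that by (auto simp: B_def)
      then show ?thesis using cInf_lower[OF _ bB] w by auto
    qed
    have zw: "\<rho> x z < \<rho> x w" "\<rho> z w = \<rho> x w - \<rho> x z"
      using ns z w iso by (force simp: image_iff)+
    have zP: "z \<in> P" and wP: "w \<in> P" using z w CP by auto
    obtain r where r: "r > 0" and
      btw: "\<And>y s. \<lbrakk>y \<in> P; 0 \<le> s; s \<le> \<rho> z y; s < r\<rbrakk> \<Longrightarrow> \<exists>u\<in>P. \<rho> z u = s \<and> \<rho> u y = \<rho> z y - s"
      using exact_between[OF assms(2,3) zP] by metis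
    \<comment> \<open>Below \<open>r\<close>, \<open>exact_between\<close> applies at
      \<open>z\<close>; below \<open>\<rho> z w\<close>, the new point falls strictly inside the
      gap.\<close>
    define e where "e = min (r/2) (\<rho> z w / 2)"
    have e: "0 < e" "e < \<rho> z w" "e < r" using r zw by (auto simp: e_def min_def field_simps)
    then obtain u where u: "u \<in> P" "\<rho> z u = e" "\<rho> u w = \<rho> z w - e"
      using btw[OF wP, of e] by auto
    have ru: "\<rho> x u = \<rho> x z + e"
      using tri[of x z u] tri[of x u w] x zP wP u zw by auto
    have "u \<in> C"
    proof (rule insertI[OF u(1)])
      show "\<rho> x u \<le> L" using ru CL[OF w(1)] zw e by auto
      fix v assume v: "v \<in> C"
      then have vP: "v \<in> P" using CP by auto
      \<comment> \<open>Points before the gap are reached through \<open>z\<close>, points after it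
        through \<open>w\<close>; the triangle inequality from \<open>x\<close> gives the opposite
        estimate.\<close>
      show "\<rho> u v = \<bar>\<rho> x u - \<rho> x v\<bar>"
        using gap[OF v]
      proof
        assume "\<rho> x v \<le> \<rho> x z"
        then show ?thesis
          using tri[OF u(1) zP vP] tri[OF x vP u(1)] iso[OF z(1) v] ru u(2)
            sym[OF u(1) vP] sym[OF u(1) zP] e by linarith
      next
        assume "\<rho> x w \<le> \<rho> x v"
        then show ?thesis
          using tri[OF u(1) wP vP] tri[OF x u(1) vP] iso[OF w(1) v] ru u(3) zw e by linarith
      qed
    qed
    then show False using gap[of u] ru e zw by linarith
  qed
  \<comment> \<open>Points with the same coordinate are at distance 0 but need not coincide. Hence
    the choice, and endpoints determined only up to distance 0.\<close>
  define \<gamma> where "\<gamma> s = (SOME z. z \<in> C \<and> \<rho> x z = s)" for s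
  have \<gamma>: "\<gamma> s \<in> C \<and> \<rho> x (\<gamma> s) = s" if s: "s \<in> {0..L}" for s
  proof -
    obtain z where "z \<in> C \<and> \<rho> x z = s"
      using img[of s] s by auto
    then show ?thesis
      unfolding \<gamma>_def by (rule someI)
  qed
  have g0: "\<gamma> 0 \<in> C" "\<rho> x (\<gamma> 0) = 0" and gL: "\<gamma> L \<in> C" "\<rho> x (\<gamma> L) = L"
    using \<gamma>[of 0] \<gamma>[of L] L0 by auto
  show ?thesis
  proof (rule that[of \<gamma>, folded L_def])
    show "\<gamma> ` {0..L} \<subseteq> P" using \<gamma> CP by auto
    show "\<rho> (\<gamma> 0) x = 0" using iso[OF g0(1) xC] g0 refl[OF x] by simp
    show "\<rho> (\<gamma> L) y = 0" using iso[OF gL(1) yC] gL by (simp add: L_def)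
    show "\<rho> (\<gamma> s) (\<gamma> t) = \<bar>s - t\<bar>" if "s \<in> {0..L}" "t \<in> {0..L}" for s t
      using \<gamma>[OF that(1)] \<gamma>[OF that(2)] iso by simp
  qed
qed

end

text \<open>All that is used of a length metric: the connected set is the image of an almost shortest curve.\<close>

definition (in Metric_space) almost_convex :: "'a set \<Rightarrow> bool" where
  "almost_convex C \<longleftrightarrow> C \<subseteq> M \<and> (\<forall>x\<in>C. \<forall>y\<in>C. \<forall>e>0. \<exists>K. connectedin mtopology K \<and> K \<subseteq> C \<and> x \<in> K \<and> y \<in> K
      \<and> (\<forall>u\<in>K. d x u + d u y < d x y + e))"

text \<open>Intermediate value theorem for \<open>d x\<close> on \<open>K\<close>; it replaces the
  choice of a parameter on a curve.\<close>

lemma (in Metric_space) connectedin_dist_attains: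
  assumes K: "connectedin mtopology K" and x: "x \<in> K" and y: "y \<in> K" and s: "0 \<le> s" "s \<le> d x y"
  obtains u where "u \<in> K" "d x u = s"
proof -
  have xM: "x \<in> M" using K x connectedin_subset_topspace by fastforce
  then have "continuous_map mtopology euclidean (d x)"
    using continuous_on_mdist[of x Self] by (simp add: mtopology_of_def)
  then have "connected (d x ` K)"
    using connectedin_continuous_map_image[OF _ K] by fastforce
  moreover have "0 \<in> d x ` K" "d x y \<in> d x ` K"
    using x y xM by (auto intro: image_eqI[of _ _ x])
  ultimately have "s \<in> d x ` K"
    using s connected_contains_Icc[of "d x ` K" 0 "d x y"] by auto
  then show ?thesis using that by blast
qed

section \<open>Hopf-Rinow for complete, locally compact, almost convex metric spaces\<close>

context Metric_space
begin

lemma pseudo_metric: "pseudo_metric M d"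
  by unfold_locales (auto simp: commute triangle)

lemma pseudo_metric_complete: "mcomplete \<Longrightarrow> pseudo_metric.complete M d"
  unfolding pseudo_metric.complete_def[OF pseudo_metric] mcomplete_def MCauchy_def limitin_metric_dist_null
  by meson

lemma pseudo_metric_locally_seq_compact:
  assumes "locally_compact_space mtopology"
  shows "pseudo_metric.locally_seq_compact M d"
  unfolding pseudo_metric.locally_seq_compact_def[OF pseudo_metric]
proof
  fix p assume p: "p \<in> M"
  then obtain U K where U: "openin mtopology U" "compactin mtopology K" "p \<in> U" "U \<subseteq> K"
    using assms unfolding locally_compact_space_def topspace_mtopology by metis
  then obtain r where r: "r > 0" "mball p r \<subseteq> U"
    unfolding openin_mtopology by blast
  have "\<exists>x\<in>M. \<exists>k. strict_mono k \<and> (\<lambda>n. d (u (k n)) x) \<longlonglongrightarrow> 0"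
    if u: "range u \<subseteq> {x \<in> M. d p x < r}" for u :: "nat \<Rightarrow> 'a"
  proof -
    have "{x \<in> M. d p x < r} \<subseteq> mball p r" using p by auto
    then have "range u \<subseteq> K" using u r(2) U(4) by blast
    then obtain x k where xk: "strict_mono (k::nat \<Rightarrow> nat)" "limitin mtopology (u \<circ> k) x sequentially"
      using U(2) unfolding compactin_sequentially by blast
    then have "x \<in> M" "(\<lambda>n. d (u (k n)) x) \<longlonglongrightarrow> 0"
      by (auto simp: limitin_metric_dist_null)
    then show ?thesis using xk(1) by blast
  qed
  then show "\<exists>r>0. \<forall>u::nat \<Rightarrow> 'a. range u \<subseteq> {x \<in> M. d p x < r} \<longrightarrow>
      (\<exists>x\<in>M. \<exists>k. strict_mono k \<and> (\<lambda>n. d (u (k n)) x) \<longlonglongrightarrow> 0)"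
    using r(1) by blast
qed

lemma pseudo_metric_approx_between:
  assumes "almost_convex M"
  shows "pseudo_metric.approx_between M d"
  unfolding pseudo_metric.approx_between_def[OF pseudo_metric]
proof (intro ballI allI impI)
  fix x y s and \<delta> :: real
  assume x: "x \<in> M" and y: "y \<in> M" and s: "s \<in> {0..d x y}" and "\<delta> > 0"
  then obtain K where K: "connectedin mtopology K" "K \<subseteq> M" "x \<in> K" "y \<in> K"
    "\<And>u. u \<in> K \<Longrightarrow> d x u + d u y < d x y + \<delta>"
    using assms unfolding almost_convex_def by meson
  obtain u where u: "u \<in> K" "d x u = s"
    using connectedin_dist_attains[OF K(1,3,4)] s by auto
  then show "\<exists>u\<in>M. d x u \<le> s \<and> d u y \<le> d x y - s + \<delta>"
    using K(2) K(5)[OF u(1)] by (intro bexI[of _ u]) auto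
qed

lemma Metric_Hopf_Rinow:
  assumes "mcomplete" "locally_compact_space mtopology" "almost_convex M" "x \<in> M" "y \<in> M"
  obtains c where "c ` {0..d x y} \<subseteq> M" "c 0 = x" "c (d x y) = y"
    "\<And>s t. \<lbrakk>s \<in> {0..d x y}; t \<in> {0..d x y}\<rbrakk> \<Longrightarrow> d (c s) (c t) = \<bar>s - t\<bar>"
proof -
  obtain c where c: "c ` {0..d x y} \<subseteq> M" "d (c 0) x = 0" "d (c (d x y)) y = 0"
    "\<And>s t. \<lbrakk>s \<in> {0..d x y}; t \<in> {0..d x y}\<rbrakk> \<Longrightarrow> d (c s) (c t) = \<bar>s - t\<bar>"
    using pseudo_metric.Hopf_Rinow[OF pseudo_metric pseudo_metric_complete
        pseudo_metric_locally_seq_compact pseudo_metric_approx_between] assms by metis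
  have "c 0 \<in> M" "c (d x y) \<in> M" using c(1) by auto
  then show ?thesis using that c assms by auto
qed

end

section \<open>Charts\<close>

lemma openin_subtopology_mono:
  "\<lbrakk>openin (subtopology T S) A; A \<subseteq> S'; S' \<subseteq> S\<rbrakk> \<Longrightarrow> openin (subtopology T S') A"
  unfolding openin_subtopology by blast

text \<open>The local condition makes \<open>T \<inter> A\<close> relatively closed in
  \<open>T\<close>, so nothing of the connected set \<open>T\<close> can remain outside
  \<open>A\<close>.\<close>

lemma connectedin_subset_open:
  assumes T: "connectedin X T" and A: "openin X A" "T \<inter> A \<noteq> {}"
    and loc: "\<And>z. z \<in> T \<Longrightarrow> \<exists>W. openin X W \<and> z \<in> W \<and> (W \<inter> A \<inter> T \<noteq> {} \<longrightarrow> z \<in> A)"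
  shows "T \<subseteq> A"
proof (rule ccontr)
  assume n: "\<not> T \<subseteq> A"
  define J where "J = \<Union>{W. openin X W \<and> W \<inter> A \<inter> T = {}}"
  have "openin X J" unfolding J_def by blast
  moreover have "T \<subseteq> A \<union> J" using loc unfolding J_def by blast
  moreover have "J \<inter> A \<inter> T = {}" unfolding J_def by blast
  moreover have "J \<inter> T \<noteq> {}" using n \<open>T \<subseteq> A \<union> J\<close> by blast
  ultimately show False
    using T A unfolding connectedin by blast
qed

text \<open>The target \<open>M\<close> is the image of \<open>f\<close> itself, with real
  distances. Local convexity is kept only as \<open>almost_convex\<close>, which does not mention
  curves.\<close>

locale local_global = Metric_space M d
  for M :: "'b set" and d :: "'b \<Rightarrow> 'b \<Rightarrow> real" +
  fixes X :: "'a topology" and f :: "'a \<Rightarrow> 'b"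
  assumes normal: "normal_space X" and Hausdorff: "Hausdorff_space X" and conn: "connected_space X"
    and cont: "continuous_map X mtopology f" and closed_f: "closed_map X mtopology f"
    and onto: "f ` topspace X = M"
    and mcomplete: "mcomplete" and loc_cpt: "locally_compact_space mtopology"
    and loc_open: "locally_open_onto_image X mtopology f"
    and lfc: "locally_fiber_connected X f"
    and loc_convex: "neighbourhood_base_of (\<lambda>U. almost_convex (f ` U)) X"
begin

text \<open>The argument takes place in the quotient of \<open>X\<close> by this relation, which is never formed.\<close>

definition sim :: "'a \<Rightarrow> 'a \<Rightarrow> bool" where
  "sim x y \<longleftrightarrow> (\<exists>T. connectedin X T \<and> x \<in> T \<and> y \<in> T \<and> (\<forall>z\<in>T. f z = f x))"

lemma f_in [simp]: "x \<in> topspace X \<Longrightarrow> f x \<in> M"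
  using imageI[of x "topspace X" f] onto by simp

lemma sim_topspace: "sim x y \<Longrightarrow> x \<in> topspace X" "sim x y \<Longrightarrow> y \<in> topspace X"
  unfolding sim_def by (meson connectedin_subset_topspace in_mono)+

lemma sim_f:
  assumes "sim x y"
  shows "f x = f y"
proof -
  obtain T where "y \<in> T" "\<forall>z\<in>T. f z = f x"
    using assms unfolding sim_def by blast
  then have "f y = f x" by simp
  then show ?thesis by (rule sym)
qed

lemma sim_refl: "x \<in> topspace X \<Longrightarrow> sim x x"
  unfolding sim_def by (rule exI[of _ "{x}"]) auto

lemma sim_sym:
  assumes "sim x y"
  shows "sim y x"
proof -
  obtain T where T: "connectedin X T" "x \<in> T" "y \<in> T" "\<forall>z\<in>T. f z = f x"
    using assms unfolding sim_def by blast
  have "\<forall>z\<in>T. f z = f y"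
    unfolding sim_f[OF assms, symmetric] by (rule T(4))
  then show ?thesis
    unfolding sim_def using T by blast
qed

lemma sim_trans:
  assumes "sim x y" "sim y z"
  shows "sim x z"
proof -
  have eq: "f x = f y" using assms(1) by (rule sim_f)
  obtain T where T: "connectedin X T" "x \<in> T" "y \<in> T" "\<forall>w\<in>T. f w = f x"
    using assms(1) unfolding sim_def by blast
  obtain T' where T': "connectedin X T'" "y \<in> T'" "z \<in> T'" "\<forall>w\<in>T'. f w = f y"
    using assms(2) unfolding sim_def by blast
  have "connectedin X (T \<union> T')"
    using T T' by (intro connectedin_Un) blast+
  moreover have "\<forall>w\<in>T \<union> T'. f w = f x"
    using T(4) T'(4) eq by (simp add: ball_Un)
  ultimately show ?thesis
    unfolding sim_def using T(2) T'(3) by blast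
qed

lemma LFC_sim:
  assumes A: "LFC X f A" and x: "x \<in> A" "x \<in> topspace X" and y: "y \<in> A" "y \<in> topspace X"
    and eq: "f x = f y"
  shows "sim x y"
proof -
  let ?F = "subtopology X (fiber X f (f x))"
  have top: "x \<in> topspace ?F" "y \<in> topspace ?F"
    using x y unfolding fiber_def topspace_subtopology by (simp_all add: eq[symmetric])
  let ?E = "\<lambda>x. Collect (connected_component_of ?F x)"
  have "?E x \<in> connected_components_of ?F" "?E y \<in> connected_components_of ?F"
    using top by (auto simp: connected_components_of_def)
  moreover have "x \<in> ?E x" "y \<in> ?E y"
    using top by (auto simp: connected_component_of_refl)
  ultimately have "?E x = ?E y"
    using A[unfolded LFC_def, rule_format, OF x(1), of "?E x" "?E y"] x(1) y(1)
    by (metis (no_types, lifting) IntI emptyE)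
  then have "connected_component_of ?F x y"
    using \<open>y \<in> ?E y\<close> by blast
  then obtain T where "connectedin ?F T" "x \<in> T" "y \<in> T"
    unfolding connected_component_of_def by blast
  then show ?thesis
    unfolding sim_def connectedin_subtopology fiber_def by blast
qed

text \<open>On a good set \<open>f\<close> is, up to \<open>sim\<close>, a homeomorphism onto its
  image; the image need not be open in \<open>M\<close>.\<close>

definition good :: "'a set \<Rightarrow> bool" where
  "good U \<longleftrightarrow> openin X U \<and> (\<forall>x\<in>U. \<forall>y\<in>U. f x = f y \<longrightarrow> sim x y) \<and>
     (\<forall>A. openin X A \<and> A \<subseteq> U \<longrightarrow> openin (subtopology mtopology (f ` U)) (f ` A))"

lemma good_exists:
  assumes p: "p \<in> topspace X"
  obtains U where "good U" "p \<in> U"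
proof -
  obtain O' where O: "openin X O'" "p \<in> O'" "open_map (subtopology X O') (subtopology mtopology (f ` O')) f"
    using loc_open p unfolding locally_open_onto_image_def by blast
  then obtain U V where U: "openin X U" "p \<in> U" "U \<subseteq> V" "V \<subseteq> O'" "LFC X f V"
    using lfc unfolding locally_fiber_connected_def neighbourhood_base_of by metis
  have "sim x y" if "x \<in> U" "y \<in> U" "f x = f y" for x y
    using LFC_sim[OF U(5), of x y] that U(3) openin_subset[OF U(1)] by auto
  moreover have "openin (subtopology mtopology (f ` U)) (f ` A)" if "openin X A" "A \<subseteq> U" for A
  proof -
    have "openin (subtopology X O') A"
      using that U O by (intro openin_subtopology_mono[of X "topspace X" A O']) (auto simp: openin_subset)
    then have "openin (subtopology mtopology (f ` O')) (f ` A)"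
      using O unfolding open_map_def by blast
    then show ?thesis
      by (rule openin_subtopology_mono) (use that U in auto)
  qed
  ultimately have "good U" unfolding good_def using U by blast
  then show ?thesis using that U by blast
qed

section \<open>Saturation under the fibre relation\<close>

definition sat :: "'a set \<Rightarrow> 'a set" where
  "sat A = {x. \<exists>a\<in>A. sim x a}"

lemma subset_sat: "A \<subseteq> topspace X \<Longrightarrow> A \<subseteq> sat A"
  using sim_refl by (auto simp: sat_def)

text \<open>Openness spreads along a connected subset of a fibre, because \<open>f\<close> is locally open onto its
  image and locally separates fibre components.\<close>

lemma openin_sat:
  assumes A: "openin X A"
  shows "openin X (sat A)"
proof -
  let ?I = "X interior_of (sat A)"
  have "x \<in> ?I" if x: "x \<in> sat A" for x
  proof -
    obtain a where a: "a \<in> A" "sim x a"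
      using x unfolding sat_def by blast
    then obtain T where T: "connectedin X T" "x \<in> T" "a \<in> T" "\<forall>z\<in>T. f z = f x"
      unfolding sim_def by blast
    have aI: "A \<subseteq> ?I"
      using A subset_sat[OF openin_subset] by (simp add: interior_of_maximal)
    have "T \<subseteq> ?I"
    proof (rule connectedin_subset_open[OF T(1)])
      show "openin X ?I" "T \<inter> ?I \<noteq> {}" using a aI T by auto
      fix z assume z: "z \<in> T"
      then have "z \<in> topspace X" using T connectedin_subset_topspace by blast
      then obtain W where W: "good W" "z \<in> W" using good_exists by blast
      have oW: "openin X W" using W good_def by blast
      moreover have "z \<in> ?I" if "w \<in> W" "w \<in> ?I" "w \<in> T" for w
      proof -
        have "openin X (W \<inter> ?I)" using oW by (simp add: openin_Int)
        then have "openin (subtopology mtopology (f ` W)) (f ` (W \<inter> ?I))"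
          using W(1) unfolding good_def by simp
        then obtain B where B: "openin mtopology B" "f ` (W \<inter> ?I) = B \<inter> f ` W"
          unfolding openin_subtopology by blast
        \<comment> \<open>\<open>?N\<close> collects the points of \<open>W\<close> whose values
          occur on \<open>W \<inter> ?I\<close>. It contains \<open>z\<close>, since
          \<open>f z = f w\<close>; and in a good set equal values mean \<open>sim\<close>, so it
          lies in \<open>sat A\<close>.\<close>
        let ?N = "W \<inter> {x \<in> topspace X. f x \<in> B}"
        have oN: "openin X ?N"
          using oW openin_continuous_map_preimage[OF cont B(1)] by blast
        have "f z = f w" using bspec[OF T(4) z] bspec[OF T(4) that(3)] by simp
        moreover have "f w \<in> B"
        proof -
          have "f w \<in> f ` (W \<inter> ?I)" using that by blast
          then show ?thesis unfolding B(2) by blast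
        qed
        ultimately have "z \<in> ?N" using W \<open>z \<in> topspace X\<close> by simp
        have "?N \<subseteq> sat A"
        proof
          fix v assume v: "v \<in> ?N"
          then have "f v \<in> f ` (W \<inter> ?I)" using B by blast
          then obtain v' where v': "v' \<in> W" "v' \<in> ?I" "f v' = f v" by auto
          then have "sim v v'" using v W unfolding good_def by auto
          moreover have "v' \<in> sat A" using v'(2) interior_of_subset[of X "sat A"] by (rule_tac subsetD)
          ultimately show "v \<in> sat A" unfolding sat_def using sim_trans by blast
        qed
        then have "?N \<subseteq> ?I" using oN by (rule interior_of_maximal)
        then show ?thesis using \<open>z \<in> ?N\<close> by blast
      qed
      ultimately show "\<exists>W. openin X W \<and> z \<in> W \<and> (W \<inter> ?I \<inter> T \<noteq> {} \<longrightarrow> z \<in> ?I)"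
        using W by blast
    qed
    then show ?thesis using T by blast
  qed
  then have "sat A \<subseteq> ?I" by (rule subsetI)
  with interior_of_subset have "?I = sat A" by (rule subset_antisym)
  then show ?thesis using openin_interior_of by metis
qed

text \<open>Saturation leaves the image unchanged: an open \<open>A \<subseteq> sat U\<close> has
  the same image as \<open>sat A \<inter> U\<close>, which is open by \<open>openin_sat\<close> and
  lies in the good set \<open>U\<close>.\<close>

lemma good_sat:
  assumes U: "good U" "U \<subseteq> topspace X"
  shows "\<lbrakk>x \<in> sat U; y \<in> sat U; f x = f y\<rbrakk> \<Longrightarrow> sim x y"
    and "\<lbrakk>openin X A; A \<subseteq> sat U\<rbrakk> \<Longrightarrow> openin (subtopology mtopology (f ` U)) (f ` A)"
proof -
  assume "x \<in> sat U" "y \<in> sat U" "f x = f y"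
  then obtain a b where ab: "a \<in> U" "b \<in> U" "sim x a" "sim y b" unfolding sat_def by blast
  then have "sim a b"
    using U(1) sim_f \<open>f x = f y\<close> unfolding good_def by metis
  then show "sim x y" using ab sim_sym sim_trans by blast
next
  assume A: "openin X A" "A \<subseteq> sat U"
  have "f ` A = f ` (sat A \<inter> U)"
  proof safe
    fix a assume "a \<in> A"
    then obtain u where "u \<in> U" "sim a u" using A unfolding sat_def by blast
    then show "f a \<in> f ` (sat A \<inter> U)"
      using \<open>a \<in> A\<close> sim_sym sim_f unfolding sat_def by (intro image_eqI[of _ _ u]) auto
  qed (use sim_f sat_def in auto)
  moreover have "openin X (sat A \<inter> U)"
    using openin_sat A U unfolding good_def by blast
  ultimately show "openin (subtopology mtopology (f ` U)) (f ` A)"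
    using U unfolding good_def by (metis inf_le2)
qed

section \<open>Chart domains\<close>

definition pre :: "'a \<Rightarrow> real \<Rightarrow> 'a set" where
  "pre p r = {x \<in> topspace X. d (f p) (f x) < r}"

lemma openin_pre:
  assumes "p \<in> topspace X"
  shows "openin X (pre p r)"
proof -
  have "openin X {x \<in> topspace X. f x \<in> mball (f p) r}"
    by (rule openin_continuous_map_preimage[OF cont]) simp
  moreover have "{x \<in> topspace X. f x \<in> mball (f p) r} = pre p r"
    using assms by (auto simp: pre_def)
  ultimately show ?thesis by simp
qed

text \<open>In the quotient, \<open>f\<close> maps the chart domain \<open>G\<close> homeomorphically onto a ball of an
  almost convex set, and \<open>G\<close> is clopen in the preimage of the ball.\<close>

definition chart :: "'a \<Rightarrow> real \<Rightarrow> 'a set \<Rightarrow> bool" where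
  "chart p r G \<longleftrightarrow> p \<in> G \<and> 0 < r \<and> openin X G \<and> G \<subseteq> pre p r \<and> openin X (pre p r - G) \<and>
     (\<exists>C. almost_convex C \<and> f ` G = C \<inter> mball (f p) r) \<and>
     (\<forall>x\<in>G. \<forall>y\<in>G. f x = f y \<longrightarrow> sim x y) \<and>
     (\<forall>A. openin X A \<and> A \<subseteq> G \<longrightarrow> openin (subtopology mtopology (f ` G)) (f ` A))"

text \<open>Only here is normality used: it separates a fibre component from the rest of its fibre, and
  closedness of \<open>f\<close> extends the separation to the preimage of a ball.\<close>

lemma separate_fibre_component:
  assumes p: "p \<in> topspace X" and U: "good U" "p \<in> U"
  obtains G r where "p \<in> G" "r > 0" "openin X G" "G \<subseteq> sat U" "openin X (pre p r - G)"
proof -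
  define F where "F = {x \<in> topspace X. f x \<in> {f p}}"
  define E where "E = {x. sim p x}"
  have UX: "U \<subseteq> topspace X" "openin X U" using U openin_subset unfolding good_def by blast+
  have F: "closedin X F"
    unfolding F_def using p by (intro closedin_continuous_map_preimage[OF cont])
      (simp add: closedin_Hausdorff_singleton Hausdorff_space_mtopology)
  have EF: "E \<subseteq> F"
    using sim_f sim_topspace unfolding E_def F_def by fastforce
  have pE: "p \<in> E" using p sim_refl by (simp add: E_def)
  have FE: "x \<in> E" if "x \<in> F" "e \<in> E" "sim e x" for x e
    using that sim_trans unfolding E_def by blast
  \<comment> \<open>A good set meets at most one component of the fibre \<open>F\<close>, so
    \<open>J\<close> covers \<open>F - E\<close> and misses \<open>E\<close>; this makes
    \<open>E\<close> closed.\<close>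
  define J where "J = \<Union>{W. good W \<and> W \<inter> E = {}}"
  have "openin X J" unfolding J_def good_def by blast
  moreover have "F - E \<subseteq> J"
  proof
    fix q assume q: "q \<in> F - E"
    then have "q \<in> topspace X" by (simp add: F_def)
    then obtain W where W: "good W" "q \<in> W" using good_exists by blast
    have "W \<inter> E = {}"
    proof (rule ccontr)
      assume "W \<inter> E \<noteq> {}"
      then obtain e where e: "e \<in> W" "e \<in> E" by blast
      then have "f e = f q" using EF q unfolding F_def by auto
      then have "sim e q" using W e unfolding good_def by blast
      then show False using FE e q by blast
    qed
    then show "q \<in> J" using W unfolding J_def by blast
  qed
  moreover have "J \<inter> E = {}" unfolding J_def by blast
  ultimately have "E = F - J" "closedin X (F - J)" using closedin_diff[OF F] EF by blast+
  then have E: "closedin X E" by simp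
  have EU: "E \<subseteq> sat U"
    using U sim_sym unfolding E_def sat_def by blast
  have FU: "F \<inter> sat U \<subseteq> E"
  proof
    fix x assume x: "x \<in> F \<inter> sat U"
    then have "f p = f x" unfolding F_def by simp
    then show "x \<in> E"
      using good_sat(1)[OF U(1) UX(1)] x pE EU unfolding E_def by blast
  qed
  have oU: "openin X (sat U)" using UX by (simp add: openin_sat)
  \<comment> \<open>The open set \<open>sat U\<close> meets \<open>F\<close> exactly in
    \<open>E\<close>, so the rest of the fibre is closed too and normality applies.\<close>
  have "F - E = F - sat U" using EU FU by blast
  then have "closedin X (F - E)" using F oU by (simp add: closedin_diff)
  then obtain G1 G2 where G: "openin X G1" "openin X G2" "E \<subseteq> G1" "F - E \<subseteq> G2" "disjnt G1 G2"
    using normal E unfolding normal_space_def by (metis Diff_disjoint disjnt_def)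
  define G where "G = G1 \<inter> sat U"
  have oG: "openin X G" using G oU by (simp add: G_def openin_Int)
  \<comment> \<open>Tube argument: the closed set outside the two neighbourhoods misses the fibre,
    so its closed image misses a ball about \<open>f p\<close>.\<close>
  define H where "H = topspace X - (G \<union> G2)"
  have "closedin X H" unfolding H_def using oG G by blast
  then have "closedin mtopology (f ` H)" using closed_f unfolding closed_map_def by blast
  then have "openin mtopology (M - f ` H)" unfolding closedin_def by simp
  moreover have "f p \<in> M - f ` H"
  proof -
    have "F \<subseteq> G \<union> G2" using G EU by (auto simp: G_def)
    then show ?thesis using p unfolding H_def F_def by auto
  qed
  ultimately obtain r where r: "r > 0" "mball (f p) r \<subseteq> M - f ` H"
    unfolding openin_mtopology by blast
  have sub: "pre p r \<subseteq> G \<union> G2"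
  proof
    fix x assume x: "x \<in> pre p r"
    then have "f x \<in> mball (f p) r" using p by (simp add: pre_def)
    then have "x \<notin> H" using r by blast
    then show "x \<in> G \<union> G2" using x unfolding H_def pre_def by blast
  qed
  have "pre p r - G = pre p r \<inter> G2"
    using sub G(5) unfolding G_def disjnt_def by blast
  then have "openin X (pre p r - G)" using G openin_pre[OF p] by (simp add: openin_Int)
  moreover have "p \<in> G" "G \<subseteq> sat U" using pE G EU unfolding G_def by blast+
  ultimately show ?thesis using that r oG by blast
qed

lemma chart_exists:
  assumes p: "p \<in> topspace X"
  obtains r G where "chart p r G"
proof -
  obtain U where U: "good U" "p \<in> U" using good_exists p by blast
  have UX: "U \<subseteq> topspace X" "openin X U" using U openin_subset unfolding good_def by blast+
  obtain G0 r where G0: "p \<in> G0" "r > 0" "openin X G0" "G0 \<subseteq> sat U" "openin X (pre p r - G0)"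
    using separate_fibre_component[OF p U] by blast
  obtain V W where V: "openin X V" "p \<in> V" "V \<subseteq> W" "W \<subseteq> U" "almost_convex (f ` W)"
    using loc_convex U UX unfolding neighbourhood_base_of by metis
  have "openin (subtopology mtopology (f ` U)) (f ` (V \<inter> G0))"
    using V G0 by (intro good_sat(2)[OF U(1) UX(1)]) auto
  then obtain B where B: "openin mtopology B" "f ` (V \<inter> G0) = B \<inter> f ` U"
    unfolding openin_subtopology by blast
  have "f p \<in> B" using B(2) V G0 imageI[of p "V \<inter> G0" f] by simp
  then obtain s where s: "s > 0" "mball (f p) s \<subseteq> B"
    using B(1) unfolding openin_mtopology by blast
  \<comment> \<open>Radius \<open>r\<close> makes \<open>G0\<close> clopen in the preimage of the
    ball; radius \<open>s\<close> makes every value on \<open>U\<close> inside the ball a value on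
    \<open>V \<inter> G0\<close>. As \<open>V \<subseteq> W \<subseteq> U\<close>, the image of
    \<open>G\<close> is then the trace on the ball of the almost convex image of
    \<open>W\<close>.\<close>
  define r' where "r' = min r s"
  define G where "G = G0 \<inter> pre p r'"
  have rr: "0 < r'" "r' \<le> r" "r' \<le> s" using s G0 by (auto simp: r'_def)
  have pre_sub: "pre p r' \<subseteq> pre p r" using rr by (auto simp: pre_def)
  have UB: "f ` U \<inter> mball (f p) r' \<subseteq> f ` (V \<inter> G0)"
    using B(2) s(2) mball_subset_concentric[OF rr(3), of "f p"] by blast
  have Gsat: "G \<subseteq> sat U" using G0 by (auto simp: G_def)
  have fGU: "f ` G \<subseteq> f ` U"
  proof
    fix y assume "y \<in> f ` G"
    then obtain g u where "y = f g" "u \<in> U" "sim g u" using Gsat unfolding sat_def by blast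
    then show "y \<in> f ` U" using sim_f by blast
  qed
  have oG: "openin X G" using G0 openin_pre[OF p] by (simp add: G_def openin_Int)
  have "pre p r' - G = pre p r' \<inter> (pre p r - G0)" using pre_sub by (auto simp: G_def)
  then have "openin X (pre p r' - G)" using G0 openin_pre[OF p] by (simp add: openin_Int)
  moreover have "f ` G = f ` W \<inter> mball (f p) r'"
  proof
    have "f ` G \<subseteq> mball (f p) r'" using p by (auto simp: G_def pre_def)
    then show "f ` G \<subseteq> f ` W \<inter> mball (f p) r'" using fGU UB V(3) by blast
    show "f ` W \<inter> mball (f p) r' \<subseteq> f ` G"
    proof
      fix y assume y: "y \<in> f ` W \<inter> mball (f p) r'"
      then have "y \<in> f ` U \<inter> mball (f p) r'" using V(4) by blast
      then have "y \<in> f ` (V \<inter> G0)" using UB by blast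
      then obtain v where v: "y = f v" "v \<in> V" "v \<in> G0" by blast
      then have "v \<in> G"
        using y V UX unfolding G_def pre_def by auto
      then show "y \<in> f ` G" using v by blast
    qed
  qed
  moreover have "\<forall>x\<in>G. \<forall>y\<in>G. f x = f y \<longrightarrow> sim x y"
    using good_sat(1)[OF U(1) UX(1)] Gsat by blast
  moreover have "openin (subtopology mtopology (f ` G)) (f ` A)" if "openin X A" "A \<subseteq> G" for A
  proof (rule openin_subtopology_mono)
    show "openin (subtopology mtopology (f ` U)) (f ` A)"
      using that Gsat by (intro good_sat(2)[OF U(1) UX(1)]) auto
  qed (use that fGU in auto)
  moreover have "p \<in> G" "G \<subseteq> pre p r'" using G0 p rr by (auto simp: G_def pre_def)
  ultimately have "chart p r' G"
    unfolding chart_def using oG rr V(5) by blast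
  then show ?thesis using that by blast
qed

lemma chartD:
  assumes "chart p r G"
  shows "p \<in> G" "0 < r" "openin X G" "G \<subseteq> pre p r" "openin X (pre p r - G)"
    "\<And>x y. \<lbrakk>x \<in> G; y \<in> G; f x = f y\<rbrakk> \<Longrightarrow> sim x y"
    "\<And>A. \<lbrakk>openin X A; A \<subseteq> G\<rbrakk> \<Longrightarrow> openin (subtopology mtopology (f ` G)) (f ` A)"
    "G \<subseteq> topspace X"
  using assms unfolding chart_def pre_def by blast+

text \<open>A connected piece of a fibre that meets \<open>G\<close> stays over the ball, and there
  \<open>G\<close> is clopen.\<close>

lemma chart_saturated:
  assumes G: "chart p r G" and x: "x \<in> G" "sim x y"
  shows "y \<in> G"
proof -
  obtain T where T: "connectedin X T" "x \<in> T" "y \<in> T" "\<forall>z\<in>T. f z = f x"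
    using x unfolding sim_def by blast
  have "T \<subseteq> pre p r"
  proof
    fix z assume "z \<in> T"
    then have "z \<in> topspace X" "f z = f x" using T connectedin_subset_topspace by blast+
    then show "z \<in> pre p r" using x chartD(4)[OF G] unfolding pre_def by auto
  qed
  then have "T \<subseteq> G \<or> T \<inter> G = {}"
    using T(1) chartD(3,5)[OF G] unfolding connectedin by blast
  then show ?thesis using T x by blast
qed

text \<open>An ellipse with foci \<open>f x\<close> and \<open>f y\<close> that is thin enough stays inside the ball on which the
  chart is defined.\<close>

lemma chart_convex:
  assumes G: "chart p r G" and x: "x \<in> G" and y: "y \<in> G"
    and per: "d (f p) (f x) + d (f x) (f y) + d (f y) (f p) < 2 * r" and "e > 0"
  obtains K where "connectedin mtopology K" "f x \<in> K" "f y \<in> K" "K \<subseteq> f ` G"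
    "\<And>u. u \<in> K \<Longrightarrow> d (f x) u + d u (f y) < d (f x) (f y) + e"
proof -
  obtain C where C: "almost_convex C" "f ` G = C \<inter> mball (f p) r"
    using G unfolding chart_def by blast
  \<comment> \<open>Adding the triangle inequalities from \<open>f p\<close> to \<open>u\<close>
    through \<open>f x\<close> and through \<open>f y\<close> bounds \<open>2 * d (f p) u\<close> by
    the perimeter plus the excess of the detour; an excess below \<open>e'\<close> makes this less
    than \<open>2 * r\<close>.\<close>
  define e' where "e' = min e (2 * r - (d (f p) (f x) + d (f x) (f y) + d (f y) (f p)))"
  have e': "e' > 0" "e' \<le> e" "e' \<le> 2 * r - (d (f p) (f x) + d (f x) (f y) + d (f y) (f p))"
    using per \<open>e > 0\<close> by (auto simp: e'_def)
  have top: "p \<in> topspace X" "x \<in> topspace X" "y \<in> topspace X"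
    using chartD(1,8)[OF G] x y by auto
  have "f x \<in> C" "f y \<in> C" using C(2) x y by blast+
  then obtain K where K: "connectedin mtopology K" "K \<subseteq> C" "f x \<in> K" "f y \<in> K"
      "\<And>u. u \<in> K \<Longrightarrow> d (f x) u + d u (f y) < d (f x) (f y) + e'"
    using C(1) e'(1) unfolding almost_convex_def by meson
  have "u \<in> mball (f p) r" if u: "u \<in> K" for u
  proof -
    have "u \<in> M" using K C u unfolding almost_convex_def by blast
    moreover have "d (f p) u < r"
      using K(5)[OF u] e'(3) triangle[of "f p" "f x" u] triangle[of "f p" "f y" u]
        commute[of "f p" "f y"] commute[of u "f y"] top \<open>u \<in> M\<close> by auto
    ultimately show ?thesis using top by simp
  qed
  then have "K \<subseteq> f ` G" using K(2) C(2) by blast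
  then show ?thesis using that K e'(2) by (meson add_left_mono less_le_trans)
qed

text \<open>A connected set joining \<open>f x\<close> to \<open>f y\<close> lifts through the chart \<open>G'\<close>, and its lift cannot leave
  \<open>G\<close>, which is clopen in the preimage of the ball.\<close>

lemma chart_step:
  assumes G: "chart p r G" and x: "x \<in> G" and per: "d (f p) (f x) + d (f x) (f y) + d (f y) (f p) < 2 * r"
    and G': "chart q s G'" and x': "x \<in> G'" and y': "y \<in> G'"
    and per': "d (f q) (f x) + d (f x) (f y) + d (f y) (f q) < 2 * s"
  shows "y \<in> G"
proof -
  define e where "e = 2 * r - (d (f p) (f x) + d (f x) (f y) + d (f y) (f p))"
  have "e > 0" using per by (simp add: e_def)
  then obtain K where K: "connectedin mtopology K" "f x \<in> K" "f y \<in> K" "K \<subseteq> f ` G'"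
    "\<And>u. u \<in> K \<Longrightarrow> d (f x) u + d u (f y) < d (f x) (f y) + e"
    using chart_convex[OF G' x' y' per'] by metis
  have top: "p \<in> topspace X" "x \<in> topspace X" "y \<in> topspace X"
    using chartD(1,8)[OF G] chartD(8)[OF G'] x y' by auto
  let ?A = "G' \<inter> G" and ?B = "G' \<inter> (pre p r - G)"
  have "openin X ?A" "openin X ?B"
    using chartD(3,5)[OF G] chartD(3)[OF G'] by blast+
  then have oA: "openin (subtopology mtopology (f ` G')) (f ` ?A)"
    and oB: "openin (subtopology mtopology (f ` G')) (f ` ?B)"
    using chartD(7)[OF G'] by blast+
  obtain A where A: "openin mtopology A" "f ` ?A = A \<inter> f ` G'"
    using oA unfolding openin_subtopology by blast
  obtain B where B: "openin mtopology B" "f ` ?B = B \<inter> f ` G'"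
    using oB unfolding openin_subtopology by blast
  \<comment> \<open>Points of the two parts with the same value would be \<open>sim\<close> in the
    chart \<open>G'\<close>, but \<open>G\<close> is saturated.\<close>
  have disj: "f ` ?A \<inter> f ` ?B = {}"
  proof (rule ccontr)
    assume "f ` ?A \<inter> f ` ?B \<noteq> {}"
    then obtain a b where ab: "a \<in> ?A" "b \<in> ?B" "f a = f b" by blast
    then have "sim a b" using chartD(6)[OF G'] by blast
    then have "b \<in> G" using chart_saturated[OF G] ab by blast
    then show False using ab by blast
  qed
  have "u \<in> f ` ?A \<union> f ` ?B" if u: "u \<in> K" for u
  proof -
    obtain v where v: "v \<in> G'" "u = f v" using K u by blast
    then have vX: "v \<in> topspace X" using chartD(8)[OF G'] by blast
    have "d (f p) u < r"
      using K(5)[OF u] triangle[of "f p" "f x" u] triangle[of "f p" "f y" u]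
        commute[of "f p" "f y"] commute[of u "f y"] top vX v(2) by (auto simp: e_def)
    then have "v \<in> pre p r" using v vX by (simp add: pre_def)
    then show ?thesis using v by blast
  qed
  then have "K \<subseteq> A \<union> B" "A \<inter> B \<inter> K = {}"
    using A(2) B(2) disj K(4) by blast+
  moreover have "A \<inter> K \<noteq> {}" using A(2) K(2) x x' by blast
  ultimately have "B \<inter> K = {}"
    using K(1) A(1) B(1) unfolding connectedin by blast
  then have "f y \<in> f ` ?A" using K \<open>K \<subseteq> A \<union> B\<close> A(2) by blast
  then obtain a where "a \<in> ?A" "f a = f y" by (metis imageE)
  then have "sim a y" using chartD(6)[OF G'] y' by blast
  then show ?thesis using chart_saturated[OF G] \<open>a \<in> ?A\<close> by blast
qed

section \<open>The chain metric\<close>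

text \<open>The perimeter condition survives subdividing the step from \<open>x\<close> to \<open>y\<close> at an almost
  intermediate point; a condition on the distances from \<open>p\<close> alone would not.\<close>

definition adj :: "'a \<Rightarrow> 'a \<Rightarrow> bool" where
  "adj x y \<longleftrightarrow> (\<exists>p r G. chart p r G \<and> x \<in> G \<and> y \<in> G \<and>
     d (f p) (f x) + d (f x) (f y) + d (f y) (f p) < 2 * r)"

lemma adjI:
  "\<lbrakk>chart p r G; x \<in> G; y \<in> G; d (f p) (f x) + d (f x) (f y) + d (f y) (f p) < 2 * r\<rbrakk> \<Longrightarrow> adj x y"
  unfolding adj_def by blast

lemma adj_topspace: "adj x y \<Longrightarrow> x \<in> topspace X \<and> y \<in> topspace X"
  unfolding adj_def using chartD(8) by blast

lemma adj_sym:
  assumes "adj x y"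
  shows "adj y x"
proof -
  obtain p r G where G: "chart p r G" "x \<in> G" "y \<in> G"
    "d (f p) (f x) + d (f x) (f y) + d (f y) (f p) < 2 * r"
    using assms unfolding adj_def by blast
  show ?thesis
    by (rule adjI[OF G(1,3,2)]) (use G(4) commute[of "f x" "f y"] commute[of "f p" "f x"] commute[of "f p" "f y"] in linarith)
qed

lemma chart_adj_center:
  assumes G: "chart p r G" and x: "x \<in> G"
  shows "adj p x"
proof (rule adjI[OF G chartD(1)[OF G] x])
  have "p \<in> topspace X" "d (f p) (f x) < r"
    using chartD(1,4,8)[OF G] x unfolding pre_def by blast+
  then show "d (f p) (f p) + d (f p) (f x) + d (f x) (f p) < 2 * r"
    using commute[of "f x" "f p"] by simp
qed

text \<open>If the detour through \<open>f u\<close> exceeds \<open>d (f x) (f y)\<close> by less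
  than \<open>e\<close>, the triangles \<open>f p, f x, f u\<close> and \<open>f p, f u, f y\<close>
  have perimeter less than the old one plus \<open>e\<close>, so both halves remain adjacent through
  the same chart.\<close>

lemma adj_split:
  assumes xy: "adj x y" and s: "0 \<le> s" "s \<le> d (f x) (f y)" and "\<delta> > 0"
  obtains u where "adj x u" "adj u y" "d (f x) (f u) = s" "d (f u) (f y) \<le> d (f x) (f y) - s + \<delta>"
proof -
  obtain p r G where G: "chart p r G" "x \<in> G" "y \<in> G"
    and per: "d (f p) (f x) + d (f x) (f y) + d (f y) (f p) < 2 * r"
    using xy unfolding adj_def by blast
  define e where "e = min \<delta> (2 * r - (d (f p) (f x) + d (f x) (f y) + d (f y) (f p)))"
  have e: "e > 0" "e \<le> \<delta>" "e \<le> 2 * r - (d (f p) (f x) + d (f x) (f y) + d (f y) (f p))"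
    using per \<open>\<delta> > 0\<close> by (auto simp: e_def)
  obtain K where K: "connectedin mtopology K" "f x \<in> K" "f y \<in> K" "K \<subseteq> f ` G"
    "\<And>u. u \<in> K \<Longrightarrow> d (f x) u + d u (f y) < d (f x) (f y) + e"
    using chart_convex[OF G per e(1)] by metis
  obtain v where v: "v \<in> K" "d (f x) v = s"
    using connectedin_dist_attains[OF K(1-3) s] by blast
  then obtain u where u: "u \<in> G" "v = f u" using K(4) by blast
  have top: "f p \<in> M" "f x \<in> M" "f y \<in> M" "f u \<in> M"
    using chartD(1,8)[OF G(1)] G u by auto
  have le: "d (f x) (f u) + d (f u) (f y) < d (f x) (f y) + e"
    using K(5) v u by blast
  show ?thesis
  proof (rule that)
    show "adj x u"
      by (rule adjI[OF G(1,2) u(1)])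
        (use le e(3) triangle[of "f u" "f y" "f p"] top in linarith)
    show "adj u y"
      by (rule adjI[OF G(1) u(1) G(3)])
        (use le e(3) triangle[of "f p" "f x" "f u"] top in linarith)
    show "d (f x) (f u) = s" using u v by simp
    show "d (f u) (f y) \<le> d (f x) (f y) - s + \<delta>" using le e(2) u v by simp
  qed
qed

text \<open>Chains replace curves in the quotient of \<open>X\<close>, so that no curve has to be lifted from \<open>Y\<close>.\<close>

inductive chain :: "'a \<Rightarrow> 'a \<Rightarrow> real \<Rightarrow> bool" where
  nil: "x \<in> topspace X \<Longrightarrow> chain x x 0"
| step: "\<lbrakk>adj x y; chain y z L\<rbrakk> \<Longrightarrow> chain x z (d (f x) (f y) + L)"

lemma chain_topspace: "chain x y L \<Longrightarrow> x \<in> topspace X \<and> y \<in> topspace X"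
  by (induction rule: chain.induct) (auto dest: adj_topspace)

lemma chain_adj: "adj x y \<Longrightarrow> chain x y (d (f x) (f y))"
  using chain.step[OF _ chain.nil] adj_topspace by fastforce

lemma chain_append: "chain x y L \<Longrightarrow> chain y z L' \<Longrightarrow> chain x z (L + L')"
  by (induction rule: chain.induct) (auto simp: add.assoc intro: chain.step)

lemma chain_sym: "chain x y L \<Longrightarrow> chain y x L"
proof (induction rule: chain.induct)
  case (step x y z L)
  then show ?case
    using chain_append[OF step(3) chain_adj[OF adj_sym[OF step(1)]]]
    by (simp add: add.commute commute)
qed (rule chain.nil)

lemma chain_ge: "chain x y L \<Longrightarrow> d (f x) (f y) \<le> L"
proof (induction rule: chain.induct)
  case (step x y z L)
  then show ?case
    using triangle[of "f x" "f y" "f z"] adj_topspace[OF step(1)] chain_topspace[OF step(2)] by auto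
qed simp

text \<open>Only the step in which length \<open>s\<close> is reached has to be subdivided, so the
  error \<open>\<delta>\<close> is incurred once.\<close>

lemma chain_split:
  assumes "chain x y L" "0 \<le> s" "s \<le> L" "\<delta> > 0"
  shows "\<exists>u L1 L2. chain x u L1 \<and> chain u y L2 \<and> L1 \<le> s \<and> L2 \<le> L - s + \<delta>"
  using assms
proof (induction arbitrary: s rule: chain.induct)
  case (nil x)
  then show ?case using chain.nil by fastforce
next
  case (step x y z L)
  show ?case
  proof (cases "s \<le> d (f x) (f y)")
    case True
    then obtain u where u: "adj x u" "adj u y" "d (f x) (f u) = s" "d (f u) (f y) \<le> d (f x) (f y) - s + \<delta>"
      using adj_split[OF step(1) step(4) _ step(6)] by blast
    then show ?thesis
      using chain_adj[OF u(1)] chain.step[OF u(2) step(2)] by force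
  next
    case False
    then obtain u L1 L2 where "chain y u L1" "chain u z L2" "L1 \<le> s - d (f x) (f y)"
      "L2 \<le> L - (s - d (f x) (f y)) + \<delta>"
      using step.IH[of "s - d (f x) (f y)"] step.prems by auto
    then show ?thesis
      using chain.step[OF step(1)] by (intro exI[of _ u] exI[of _ "d (f x) (f y) + L1"] exI[of _ L2]) auto
  qed
qed

text \<open>The points reachable from \<open>x\<close> form a clopen set, because a chart links its
  centre to each of its points. The infimum defining \<open>rho\<close> is therefore taken over a
  nonempty set.\<close>

lemma chain_exists:
  assumes x: "x \<in> topspace X" and y: "y \<in> topspace X"
  obtains L where "chain x y L"
proof -
  define A where "A = {y. \<exists>L. chain x y L}"
  have sub: "A \<subseteq> topspace X" using chain_topspace by (auto simp: A_def)
  have nbhd: "\<exists>G. openin X G \<and> z \<in> G \<and> (G \<subseteq> A \<or> G \<inter> A = {})" if z: "z \<in> topspace X" for z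
  proof -
    obtain r G where G: "chart z r G" using chart_exists[OF z] by blast
    have "w \<in> A \<longleftrightarrow> z \<in> A" if w: "w \<in> G" for w
    proof -
      have "chain z w (d (f z) (f w))" using chain_adj[OF chart_adj_center[OF G w]] .
      then show ?thesis
        unfolding A_def using chain_append chain_sym by blast
    qed
    then show ?thesis using chartD(1,3)[OF G] by blast
  qed
  have "openin X A"
    by (subst openin_subopen) (use nbhd sub in blast)
  moreover have "openin X (topspace X - A)"
  proof (subst openin_subopen, rule ballI)
    fix z assume z: "z \<in> topspace X - A"
    then obtain G where "openin X G" "z \<in> G" "G \<subseteq> A \<or> G \<inter> A = {}" using nbhd by blast
    then show "\<exists>T. openin X T \<and> z \<in> T \<and> T \<subseteq> topspace X - A"
      using z openin_subset[of X G] by (intro exI[of _ G]) blast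
  qed
  ultimately have "A = {} \<or> A = topspace X"
    using conn sub unfolding connected_space_clopen_in closedin_def by blast
  moreover have "x \<in> A" using chain.nil[OF x] by (auto simp: A_def)
  ultimately show ?thesis using y that by (auto simp: A_def)
qed

section \<open>The chain metric as an infimum\<close>

definition rho :: "'a \<Rightarrow> 'a \<Rightarrow> real" where
  "rho x y = Inf {L. chain x y L}"

lemma rho_bdd: "bdd_below {L. chain x y L}"
  using chain_ge by (intro bdd_belowI[of _ "d (f x) (f y)"]) auto

lemma rho_le: "chain x y L \<Longrightarrow> rho x y \<le> L"
  unfolding rho_def using rho_bdd by (intro cInf_lower) auto

lemma rho_ge:
  assumes "x \<in> topspace X" "y \<in> topspace X"
  shows "d (f x) (f y) \<le> rho x y"
proof -
  obtain L where "chain x y L" using chain_exists[OF assms] by blast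
  then show ?thesis
    unfolding rho_def using chain_ge by (intro cInf_greatest) auto
qed

lemma rho_less:
  assumes "x \<in> topspace X" "y \<in> topspace X" "rho x y < c"
  obtains L where "chain x y L" "L < c"
proof -
  have "{L. chain x y L} \<noteq> {}" using chain_exists[OF assms(1,2)] by blast
  then show ?thesis
    using assms(3) that cInf_less_iff[OF _ rho_bdd] unfolding rho_def by blast
qed

sublocale rho: pseudo_metric "topspace X" rho
proof
  fix x assume x: "x \<in> topspace X"
  show "rho x x = 0"
    using rho_le[OF chain.nil[OF x]] rho_ge[OF x x] nonneg[of "f x" "f x"] by linarith
next
  fix x y
  have "{L. chain x y L} = {L. chain y x L}" using chain_sym by blast
  then show "rho x y = rho y x" by (simp add: rho_def)
next
  fix x y z assume x: "x \<in> topspace X" and y: "y \<in> topspace X" and z: "z \<in> topspace X"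
  show "rho x z \<le> rho x y + rho y z"
  proof (rule field_le_epsilon)
    fix e :: real assume "e > 0"
    then have "rho x y < rho x y + e/2" "rho y z < rho y z + e/2" by auto
    then obtain L L' where L: "chain x y L" "L < rho x y + e/2" and L': "chain y z L'" "L' < rho y z + e/2"
      using rho_less[OF x y] rho_less[OF y z] by metis
    then show "rho x z \<le> rho x y + rho y z + e"
      using rho_le[OF chain_append[OF L(1) L'(1)]] by linarith
  qed
qed

lemma rho_approx_between: "rho.approx_between"
  unfolding rho.approx_between_def
proof (intro ballI allI impI)
  fix x y s and \<delta> :: real
  assume x: "x \<in> topspace X" and y: "y \<in> topspace X" and s: "s \<in> {0..rho x y}" and "\<delta> > 0"
  then obtain L where L: "chain x y L" "L < rho x y + \<delta>/2"
    using rho_less[OF x y, of "rho x y + \<delta>/2"] by auto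
  have "s \<le> L" using s rho_le[OF L(1)] by auto
  then obtain u L1 L2 where u: "chain x u L1" "chain u y L2" "L1 \<le> s" "L2 \<le> L - s + \<delta>/2"
    using chain_split[OF L(1), of s "\<delta>/2"] s \<open>\<delta> > 0\<close> by auto
  then show "\<exists>u\<in>topspace X. rho x u \<le> s \<and> rho u y \<le> rho x y - s + \<delta>"
    using rho_le[OF u(1)] rho_le[OF u(2)] L(2) chain_topspace[OF u(1)] by (intro bexI[of _ u]) auto
qed

text \<open>By the triangle inequality a step from \<open>x\<close> to \<open>y\<close> has
  perimeter at most \<open>2 * (d (f p) (f x) + d (f x) (f y))\<close>, which the length budget
  keeps below \<open>2 * r\<close>. So \<open>chart_step\<close> applies to each step in turn,
  whatever chart the step was taken in.\<close>

lemma chain_in_chart: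
  assumes G: "chart p r G"
  shows "chain x y L \<Longrightarrow> x \<in> G \<Longrightarrow> d (f p) (f x) + L < r \<Longrightarrow> y \<in> G"
proof (induction rule: chain.induct)
  case (step x y z L)
  obtain q s G' where G': "chart q s G'" "x \<in> G'" "y \<in> G'"
    "d (f q) (f x) + d (f x) (f y) + d (f y) (f q) < 2 * s"
    using step(1) unfolding adj_def by blast
  have top: "f p \<in> M" "f x \<in> M" "f y \<in> M"
    using chartD(1,8)[OF G] adj_topspace[OF step(1)] by auto
  have "0 \<le> L" using order_trans[OF nonneg chain_ge[OF step(2)]] .
  have tri: "d (f p) (f y) \<le> d (f p) (f x) + d (f x) (f y)" using top by (rule triangle)
  have "y \<in> G"
    by (rule chart_step[OF G step(4) _ G']) (use tri step(5) \<open>0 \<le> L\<close> commute[of "f y" "f p"] in linarith)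
  then show ?case using step.IH step(5) tri by linarith
qed simp

text \<open>With \<open>rho_eq_dist_center\<close>, this identifies the chart domain with the open
  \<open>rho\<close>-ball of radius \<open>r\<close> about its centre.\<close>

lemma rho_less_in_chart:
  assumes G: "chart p r G" and x: "x \<in> topspace X" "rho p x < r"
  shows "x \<in> G"
proof -
  have p: "p \<in> topspace X" using chartD(1,8)[OF G] by blast
  obtain L where "chain p x L" "L < r" using rho_less[OF p x] by blast
  then show ?thesis
    using chain_in_chart[OF G _ chartD(1)[OF G]] p by simp
qed

lemma rho_eq_dist:
  assumes "chart p r G" "x \<in> G" "y \<in> G" "d (f p) (f x) + d (f x) (f y) + d (f y) (f p) < 2 * r"
  shows "rho x y = d (f x) (f y)"
proof -
  have "x \<in> topspace X" "y \<in> topspace X" using chartD(8)[OF assms(1)] assms by auto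
  then show ?thesis
    using rho_le[OF chain_adj[OF adjI[OF assms]]] rho_ge by force
qed

lemma rho_eq_dist_center:
  assumes G: "chart p r G" and x: "x \<in> G"
  shows "rho p x = d (f p) (f x)"
  using rho_le[OF chain_adj[OF chart_adj_center[OF G x]]] rho_ge[of p x] chartD(1,8)[OF G] x by force

text \<open>Within \<open>r/2\<close> of the centre two values are less than \<open>r\<close> apart,
  so the perimeter is below \<open>2 * r\<close>.\<close>

lemma rho_local_isometry:
  assumes p: "p \<in> topspace X"
  obtains \<epsilon> where "\<epsilon> > 0"
    "\<And>x y. \<lbrakk>x \<in> topspace X; y \<in> topspace X; rho p x < \<epsilon>; rho p y < \<epsilon>\<rbrakk> \<Longrightarrow> rho x y = d (f x) (f y)"
proof -
  obtain r G where G: "chart p r G" using chart_exists[OF p] by blast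
  have r: "r > 0" using chartD(2)[OF G] .
  have "rho x y = d (f x) (f y)"
    if xy: "x \<in> topspace X" "y \<in> topspace X" "rho p x < r/2" "rho p y < r/2" for x y
  proof (rule rho_eq_dist[OF G])
    show "x \<in> G" "y \<in> G" using rho_less_in_chart[OF G] xy r by auto
    have "d (f p) (f x) < r/2" "d (f p) (f y) < r/2"
      using rho_ge[OF p] xy by force+
    then show "d (f p) (f x) + d (f x) (f y) + d (f y) (f p) < 2 * r"
      using triangle[of "f x" "f p" "f y"] commute[of "f x" "f p"] commute[of "f y" "f p"] p xy by auto
  qed
  then show ?thesis using that[of "r/2"] r by simp
qed

text \<open>A chart around \<open>x\<close> contains every point at \<open>rho\<close>-distance 0,
  and on a chart equal values imply \<open>sim\<close>.\<close>

lemma rho_eq_0: 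
  assumes "x \<in> topspace X" "y \<in> topspace X" "rho x y = 0"
  shows "sim x y"
proof -
  obtain r G where G: "chart x r G" using chart_exists[OF assms(1)] by blast
  have "y \<in> G" using rho_less_in_chart[OF G] assms chartD(2)[OF G] by simp
  moreover have "f x = f y" using rho_ge[OF assms(1,2)] assms nonneg[of "f x" "f y"] by simp
  ultimately show ?thesis using chartD(1,6)[OF G] by blast
qed

section \<open>Local compactness and completeness of the chain metric\<close>

lemma rho_locally_seq_compact: "rho.locally_seq_compact"
  unfolding rho.locally_seq_compact_def
proof
  fix p assume p: "p \<in> topspace X"
  obtain r G where G: "chart p r G" using chart_exists[OF p] by blast
  obtain U K where U: "openin mtopology U" "compactin mtopology K" "f p \<in> U" "U \<subseteq> K"
    using loc_cpt f_in[OF p] unfolding locally_compact_space_def topspace_mtopology by metis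
  then obtain s where s: "s > 0" "mball (f p) s \<subseteq> U"
    unfolding openin_mtopology by blast
  \<comment> \<open>\<open>s\<close> places the values in the compact set; \<open>r/4\<close> keeps
    the closed ball of radius \<open>t\<close> inside the ball of the chart, and the perimeters, at
    most \<open>4 * t\<close>, below \<open>2 * r\<close>.\<close>
  define t where "t = min (r/4) s"
  have t: "0 < t" "t \<le> r/4" "t \<le> s" using s chartD(2)[OF G] by (auto simp: t_def)
  \<comment> \<open>\<open>Q\<close> is the part of \<open>G\<close> over a smaller closed ball. It
    is closed in \<open>X\<close> because \<open>G\<close> is clopen over the larger ball; so its
    image is closed, and a limit of values lifts into \<open>G\<close>.\<close>
  define Q where "Q = {x \<in> topspace X. f x \<in> mcball (f p) t} - (pre p r - G)"
  have "closedin X Q"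
    unfolding Q_def by (intro closedin_diff closedin_continuous_map_preimage[OF cont] chartD(5)[OF G]) simp
  then have fQ: "closedin mtopology (f ` Q)" using closed_f unfolding closed_map_def by blast
  have QG: "Q \<subseteq> G" using t unfolding Q_def pre_def by auto
  show "\<exists>r>0. \<forall>u. range u \<subseteq> {x \<in> topspace X. rho p x < r} \<longrightarrow>
      (\<exists>x\<in>topspace X. \<exists>k::nat\<Rightarrow>nat. strict_mono k \<and> (\<lambda>n. rho (u (k n)) x) \<longlonglongrightarrow> 0)"
  proof (intro exI[of _ t] conjI allI impI)
    fix u :: "nat \<Rightarrow> 'a" assume "range u \<subseteq> {x \<in> topspace X. rho p x < t}"
    then have u: "\<And>n. u n \<in> topspace X" "\<And>n. rho p (u n) < t" by auto
    have uG: "u n \<in> G" for n using rho_less_in_chart[OF G u(1)[of n]] u(2)[of n] t(1,2) by linarith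
    have du: "d (f p) (f (u n)) < t" for n using rho_ge[OF p u(1)] u(2) by (rule le_less_trans)
    have "f (u n) \<in> K" for n
    proof -
      have "f (u n) \<in> mball (f p) s" using du[of n] u(1)[of n] p t(3) by simp
      then show ?thesis using s(2) U(4) by blast
    qed
    then have "range (f \<circ> u) \<subseteq> K" by auto
    then obtain l k where k: "strict_mono (k::nat \<Rightarrow> nat)" and lim: "limitin mtopology (f \<circ> u \<circ> k) l sequentially"
      using U(2) unfolding compactin_sequentially by blast
    have "f (u n) \<in> f ` Q" for n
      using u(1)[of n] uG[of n] du[of n] p by (auto simp: Q_def)
    then have "l \<in> f ` Q"
      by (intro limitin_closedin[OF lim fQ]) auto
    then obtain x where x: "x \<in> Q" "l = f x" by blast
    have xX: "x \<in> topspace X" "x \<in> G" and dx: "d (f p) (f x) \<le> t"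
      using x QG unfolding Q_def by auto
    have "rho (u n) x = d (f (u n)) (f x)" for n
      by (rule rho_eq_dist[OF G uG xX(2)])
        (use du[of n] dx t triangle[of "f (u n)" "f p" "f x"] commute[of "f (u n)" "f p"] commute[of "f x" "f p"]
          u(1)[of n] xX p in auto)
    moreover have "(\<lambda>n. d (f (u (k n))) (f x)) \<longlonglongrightarrow> 0"
      using lim x(2) by (simp add: limitin_metric_dist_null o_def)
    ultimately have "(\<lambda>n. rho (u (k n)) x) \<longlonglongrightarrow> 0" by simp
    then show "\<exists>x\<in>topspace X. \<exists>k::nat\<Rightarrow>nat. strict_mono k \<and> (\<lambda>n. rho (u (k n)) x) \<longlonglongrightarrow> 0"
      using k xX by blast
  qed (use t in auto)
qed

text \<open>A Cauchy sequence whose \<open>f\<close>-values converge to \<open>y\<close> without ever being equal to \<open>y\<close>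
  accumulates in \<open>X\<close>, since \<open>f\<close> is closed.  A sequence in the fibre over \<open>y\<close> is first pushed off
  the fibre.\<close>

lemma rho_push_off:
  assumes x: "x \<in> topspace X" and y: "y \<in> topspace X" and pos: "0 < rho x y" and "\<delta> > 0"
  obtains v where "v \<in> topspace X" "rho x v < \<delta>" "f v \<noteq> f x"
proof -
  obtain r G where G: "chart x r G" using chart_exists[OF x] by blast
  have r: "r > 0" using chartD(2)[OF G] .
  \<comment> \<open>\<open>s \<le> rho x y\<close> permits the intermediate point,
    \<open>s < r\<close> keeps it in the chart, and the error \<open>s/2\<close> used next leaves it
    at positive distance from \<open>x\<close>; in the chart this is a distance of values.\<close>
  define s where "s = min (rho x y) (min (r/2) (\<delta>/2))"
  have s: "0 < s" "s \<le> rho x y" "s < r" "s < \<delta>" using r pos \<open>\<delta> > 0\<close> by (auto simp: s_def min_def)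
  then obtain v where v: "v \<in> topspace X" "rho x v \<le> s" "rho v y \<le> rho x y - s + s/2"
    using rho_approx_between x y unfolding rho.approx_between_def by (metis atLeastAtMost_iff half_gt_zero less_imp_le)
  have "0 < rho x v" using rho.tri[OF x v(1) y] v(3) s by linarith
  moreover have "v \<in> G" using rho_less_in_chart[OF G v(1)] v(2) s by linarith
  ultimately have "f v \<noteq> f x" using rho_eq_dist_center[OF G] x by auto
  then show ?thesis using that v s by fastforce
qed

text \<open>If the range of \<open>v\<close> were closed, its closed image would contain the limit
  \<open>y\<close>. A closure point outside the range has neighbourhoods avoiding any finite initial
  segment, as finite sets are closed, and is therefore approached by arbitrarily late terms.\<close>

lemma closed_image_limit:
  assumes v: "range v \<subseteq> topspace X" and lim: "limitin mtopology (f \<circ> v) y sequentially" and ne: "\<And>n. f (v n) \<noteq> y"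
  obtains x where "x \<in> topspace X" "\<And>T N. \<lbrakk>openin X T; x \<in> T\<rbrakk> \<Longrightarrow> \<exists>n\<ge>N. v n \<in> T"
proof -
  have "\<not> closedin X (range v)"
  proof
    assume "closedin X (range v)"
    then have "closedin mtopology (f ` range v)" using closed_f unfolding closed_map_def by blast
    then have "y \<in> f ` range v" by (intro limitin_closedin[OF lim]) auto
    then show False using ne by auto
  qed
  then have "X closure_of range v \<noteq> range v" by (simp add: closure_of_eq)
  then obtain x where x: "x \<in> X closure_of range v" "x \<notin> range v"
    using closure_of_subset[OF v] by blast
  have "\<exists>n\<ge>N. v n \<in> T" if T: "openin X T" "x \<in> T" for T N
  proof -
    have "closedin X (v ` {..<N})"
      using v Hausdorff by (intro closedin_Hausdorff_finite) auto
    then have "openin X (T - v ` {..<N})" using T by blast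
    moreover have "x \<in> T - v ` {..<N}" using T x by blast
    ultimately have "\<exists>z\<in>range v. z \<in> T - v ` {..<N}"
      using x(1)[unfolded in_closure_of, THEN conjunct2, THEN spec, of "T - v ` {..<N}"] by blast
    then obtain z where "z \<in> range v" "z \<in> T - v ` {..<N}" by blast
    then obtain n where "v n \<in> T" "v n \<notin> v ` {..<N}" by blast
    then show ?thesis by (intro exI[of _ n]) (auto simp: not_less[symmetric])
  qed
  then show ?thesis using that x(1) unfolding in_closure_of by blast
qed

lemma rho_complete: "rho.complete"
  unfolding rho.complete_def
proof (intro allI impI, elim conjE)
  fix u :: "nat \<Rightarrow> 'a"
  assume uX: "range u \<subseteq> topspace X" and cau: "\<forall>e>0. \<exists>N. \<forall>m\<ge>N. \<forall>n\<ge>N. rho (u m) (u n) < e"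
  have u: "u n \<in> topspace X" for n using uX by auto
  have "MCauchy (f \<circ> u)"
    unfolding MCauchy_def
  proof (intro conjI allI impI)
    show "range (f \<circ> u) \<subseteq> M" using u by auto
    fix e :: real assume "e > 0"
    then obtain N where "\<forall>m\<ge>N. \<forall>n\<ge>N. rho (u m) (u n) < e" using cau by blast
    then show "\<exists>N. \<forall>m n. N \<le> m \<longrightarrow> N \<le> n \<longrightarrow> d ((f \<circ> u) m) ((f \<circ> u) n) < e"
      using rho_ge[OF u u] by (metis comp_apply le_less_trans)
  qed
  then obtain y where y: "limitin mtopology (f \<circ> u) y sequentially"
    using mcomplete unfolding mcomplete_def by blast
  then have yM: "y \<in> M" and fu: "(\<lambda>n. d (f (u n)) y) \<longlonglongrightarrow> 0"
    by (auto simp: limitin_metric_dist_null)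
  \<comment> \<open>If the sequence eventually stays at distance 0 from one of its terms, that term
    is a limit. Otherwise each \<open>u N\<close> has positive distance from some later term, as
    \<open>rho_push_off\<close> requires.\<close>
  show "\<exists>x\<in>topspace X. (\<lambda>n. rho (u n) x) \<longlonglongrightarrow> 0"
  proof (cases "\<exists>N. \<forall>n\<ge>N. rho (u N) (u n) = 0")
    case True
    then obtain N where N: "\<And>n. n \<ge> N \<Longrightarrow> rho (u N) (u n) = 0" by blast
    have "(\<lambda>n. rho (u n) (u N)) \<longlonglongrightarrow> 0"
      by (rule tendsto_eventually) (use N rho.sym[OF u u] in \<open>auto simp: eventually_sequentially\<close>)
    then show ?thesis using u by blast
  next
    case False
    \<comment> \<open>Terms in the limiting fibre are replaced by nearby points off it; errors below
      \<open>1/(N+1)\<close> change neither the limit of the values nor a limit of the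
      sequence.\<close>
    have "\<exists>v\<in>topspace X. rho (u N) v < inverse (real (Suc N)) \<and> f v \<noteq> y" for N
    proof (cases "f (u N) = y")
      case True
      obtain n where "rho (u N) (u n) \<noteq> 0" using False by blast
      then have "0 < rho (u N) (u n)" using rho.nonneg[OF u u, of N n] by linarith
      then obtain v where "v \<in> topspace X" "rho (u N) v < inverse (real (Suc N))" "f v \<noteq> f (u N)"
        using rho_push_off[OF u u, of N n "inverse (real (Suc N))"] by auto
      then show ?thesis using True by blast
    next
      case False
      then show ?thesis using u rho.refl[OF u] by (intro bexI[of _ "u N"]) auto
    qed
    then obtain v where v: "\<And>N. v N \<in> topspace X" "\<And>N. rho (u N) (v N) < inverse (real (Suc N))" "\<And>N. f (v N) \<noteq> y"
      by metis
    have "(\<lambda>n. d (f (v n)) y) \<longlonglongrightarrow> 0"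
    proof (rule Lim_null_comparison)
      have "d (f (v n)) y \<le> inverse (real (Suc n)) + d (f (u n)) y" for n
        using triangle[of "f (v n)" "f (u n)" y] commute[of "f (v n)" "f (u n)"] yM u[of n] v(1)[of n]
          rho_ge[OF u[of n] v(1)[of n]] v(2)[of n] by auto
      then show "\<forall>\<^sub>F n in sequentially. norm (d (f (v n)) y) \<le> inverse (real (Suc n)) + d (f (u n)) y"
        by simp
      show "(\<lambda>n. inverse (real (Suc n)) + d (f (u n)) y) \<longlonglongrightarrow> 0"
        using tendsto_add[OF LIMSEQ_inverse_real_of_nat fu] by simp
    qed
    then have "limitin mtopology (f \<circ> v) y sequentially"
      using yM v(1) by (simp add: limitin_metric_dist_null o_def)
    then obtain x where x: "x \<in> topspace X" and acc: "\<And>T N. \<lbrakk>openin X T; x \<in> T\<rbrakk> \<Longrightarrow> \<exists>n\<ge>N. v n \<in> T"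
      using closed_image_limit[of v y] v by auto
    obtain r G where G: "chart x r G" using chart_exists[OF x] by blast
    have "(\<lambda>n. rho (u n) x) \<longlonglongrightarrow> 0"
    proof (rule LIMSEQ_I)
      fix e :: real assume "e > 0"
      obtain N1 where N1: "\<And>m n. m \<ge> N1 \<Longrightarrow> n \<ge> N1 \<Longrightarrow> rho (u m) (u n) < e/3"
        using cau \<open>e > 0\<close> by (meson divide_pos_pos zero_less_numeral)
      obtain N2 where N2: "inverse (real (Suc N2)) < e/3"
        using reals_Archimedean[of "e/3"] \<open>e > 0\<close> by auto
      have "openin X (G \<inter> pre x (e/3))" using chartD(3)[OF G] openin_pre[OF x] by blast
      moreover have "x \<in> G \<inter> pre x (e/3)" using chartD(1)[OF G] x \<open>e > 0\<close> by (simp add: pre_def)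
      \<comment> \<open>A single late \<open>v m\<close> near \<open>x\<close> suffices:
        \<open>u n\<close> is within \<open>e/3\<close> of \<open>u m\<close>, \<open>u m\<close> of
        \<open>v m\<close>, and \<open>v m\<close> of \<open>x\<close>.\<close>
      ultimately obtain m where m: "m \<ge> max N1 N2" "v m \<in> G" "v m \<in> pre x (e/3)"
        using acc by blast
      have 1: "rho x (v m) < e/3"
        using rho_eq_dist_center[OF G m(2)] m(3) by (simp add: pre_def)
      have "inverse (real (Suc m)) \<le> inverse (real (Suc N2))"
        using m(1) by (intro le_imp_inverse_le) auto
      then have 2: "rho (u m) (v m) < e/3" using v(2)[of m] N2 by linarith
      have "rho (u n) x < e" if "n \<ge> N1" for n
        using N1[OF that, of m] m(1) 1 2 rho.tri[OF u[of n] u[of m] x] rho.tri[OF u[of m] v(1)[of m] x]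
          rho.sym[OF x v(1)[of m]] by simp
      then show "\<exists>N. \<forall>n\<ge>N. norm (rho (u n) x - 0) < e"
        using rho.nonneg[OF u x] by (intro exI[of _ N1]) simp
    qed
    then show ?thesis using x by blast
  qed
qed

section \<open>Shortest paths of the chain metric and their images\<close>

lemma rho_geodesic:
  assumes "x \<in> topspace X" "y \<in> topspace X"
  obtains \<gamma> where "\<gamma> ` {0..rho x y} \<subseteq> topspace X" "f (\<gamma> 0) = f x" "f (\<gamma> (rho x y)) = f y"
    "\<And>s t. \<lbrakk>s \<in> {0..rho x y}; t \<in> {0..rho x y}\<rbrakk> \<Longrightarrow> rho (\<gamma> s) (\<gamma> t) = \<bar>s - t\<bar>"
proof -
  obtain \<gamma> where \<gamma>: "\<gamma> ` {0..rho x y} \<subseteq> topspace X" "rho (\<gamma> 0) x = 0" "rho (\<gamma> (rho x y)) y = 0"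
    "\<And>s t. \<lbrakk>s \<in> {0..rho x y}; t \<in> {0..rho x y}\<rbrakk> \<Longrightarrow> rho (\<gamma> s) (\<gamma> t) = \<bar>s - t\<bar>"
    using rho.Hopf_Rinow[OF rho_complete rho_locally_seq_compact rho_approx_between assms] by blast
  \<comment> \<open>Endpoints are attained only up to \<open>rho\<close>-distance 0, hence up to
    \<open>sim\<close>, which \<open>f\<close> does not see.\<close>
  have "\<gamma> 0 \<in> topspace X" "\<gamma> (rho x y) \<in> topspace X"
    using \<gamma>(1) rho.nonneg[OF assms] by auto
  then have "f (\<gamma> 0) = f x" "f (\<gamma> (rho x y)) = f y"
    using \<gamma>(2,3) rho_eq_0 assms sim_f by blast+
  then show ?thesis using that \<gamma>(1,4) by blast
qed

text \<open>The global bound yields continuity of the projected path, the local equalities its local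
  minimality; \<open>rho\<close> survives only as the length of the parameter interval.\<close>

lemma projected_rho_geodesic:
  assumes "x \<in> topspace X" "y \<in> topspace X"
  shows "\<exists>c. c ` {0..rho x y} \<subseteq> M \<and> c 0 = f x \<and> c (rho x y) = f y \<and>
    (\<forall>s\<in>{0..rho x y}. \<forall>t\<in>{0..rho x y}. d (c s) (c t) \<le> \<bar>s - t\<bar>) \<and>
    (\<forall>t\<in>{0..rho x y}. \<exists>e>0. \<forall>s\<in>{0..rho x y}. \<forall>s'\<in>{0..rho x y}. \<bar>s - t\<bar> < e \<longrightarrow> \<bar>s' - t\<bar> < e
        \<longrightarrow> d (c s) (c s') = \<bar>s - s'\<bar>)"
proof -
  let ?I = "{0..rho x y}"
  obtain \<gamma> where \<gamma>: "\<gamma> ` ?I \<subseteq> topspace X" "f (\<gamma> 0) = f x" "f (\<gamma> (rho x y)) = f y"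
    and iso: "\<And>s t. \<lbrakk>s \<in> ?I; t \<in> ?I\<rbrakk> \<Longrightarrow> rho (\<gamma> s) (\<gamma> t) = \<bar>s - t\<bar>"
    using rho_geodesic[OF assms] by blast
  have top: "\<gamma> s \<in> topspace X" if "s \<in> ?I" for s using \<gamma>(1) that by blast
  have "\<exists>e>0. \<forall>s\<in>?I. \<forall>s'\<in>?I. \<bar>s - t\<bar> < e \<longrightarrow> \<bar>s' - t\<bar> < e
      \<longrightarrow> d (f (\<gamma> s)) (f (\<gamma> s')) = \<bar>s - s'\<bar>" if t: "t \<in> ?I" for t
  proof -
    obtain e where e: "e > 0" "\<And>a b. \<lbrakk>a \<in> topspace X; b \<in> topspace X; rho (\<gamma> t) a < e; rho (\<gamma> t) b < e\<rbrakk>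
        \<Longrightarrow> rho a b = d (f a) (f b)"
      using rho_local_isometry[OF top[OF t]] by blast
    have "d (f (\<gamma> s)) (f (\<gamma> s')) = \<bar>s - s'\<bar>"
      if s: "s \<in> ?I" "s' \<in> ?I" "\<bar>s - t\<bar> < e" "\<bar>s' - t\<bar> < e" for s s'
      using e(2)[OF top[OF s(1)] top[OF s(2)]] iso[OF t s(1)] iso[OF t s(2)] iso[OF s(1,2)] s(3,4) by simp
    then show ?thesis using e(1) by auto
  qed
  moreover have "d (f (\<gamma> s)) (f (\<gamma> t)) \<le> \<bar>s - t\<bar>" if "s \<in> ?I" "t \<in> ?I" for s t
    using rho_ge[OF top top, OF that] iso[OF that] by simp
  ultimately show ?thesis
    using \<gamma> top by (intro exI[of _ "f \<circ> \<gamma>"]) auto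
qed

lemma projected_rho_geodesic_isometric:
  assumes "x \<in> topspace X" "y \<in> topspace X"
    and iso: "\<And>a b. \<lbrakk>a \<in> topspace X; b \<in> topspace X\<rbrakk> \<Longrightarrow> rho a b = d (f a) (f b)"
  shows "\<exists>c. c ` {0..rho x y} \<subseteq> M \<and> c 0 = f x \<and> c (rho x y) = f y \<and>
    (\<forall>s\<in>{0..rho x y}. \<forall>t\<in>{0..rho x y}. d (c s) (c t) = \<bar>s - t\<bar>)"
proof -
  let ?I = "{0..rho x y}"
  obtain \<gamma> where \<gamma>: "\<gamma> ` ?I \<subseteq> topspace X" "f (\<gamma> 0) = f x" "f (\<gamma> (rho x y)) = f y"
    and \<gamma>_iso: "\<And>s t. \<lbrakk>s \<in> ?I; t \<in> ?I\<rbrakk> \<Longrightarrow> rho (\<gamma> s) (\<gamma> t) = \<bar>s - t\<bar>"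
    using rho_geodesic[OF assms(1,2)] by blast
  have top: "\<gamma> s \<in> topspace X" if "s \<in> ?I" for s using \<gamma>(1) that by blast
  have "d (f (\<gamma> s)) (f (\<gamma> t)) = \<bar>s - t\<bar>" if "s \<in> ?I" "t \<in> ?I" for s t
    using iso[OF top top, OF that] \<gamma>_iso[OF that] by simp
  then show ?thesis
    using \<gamma> top by (intro exI[of _ "f \<circ> \<gamma>"]) auto
qed

section \<open>Consequences of a global isometry\<close>

lemma connected_fiber_if_isometric:
  assumes iso: "\<And>a b. \<lbrakk>a \<in> topspace X; b \<in> topspace X\<rbrakk> \<Longrightarrow> rho a b = d (f a) (f b)"
    and a: "a \<in> topspace X"
  shows "connectedin X (fiber X f (f a))"
proof -
  let ?\<T> = "{T. connectedin X T \<and> a \<in> T \<and> T \<subseteq> fiber X f (f a)}"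
  have "x \<in> \<Union>?\<T>" if x: "x \<in> fiber X f (f a)" for x
  proof -
    have "x \<in> topspace X" "f x = f a" using x by (auto simp: fiber_def)
    then have "sim a x" using iso[OF a] a by (intro rho_eq_0) auto
    then obtain T where T: "connectedin X T" "a \<in> T" "x \<in> T" "\<forall>z\<in>T. f z = f a"
      unfolding sim_def by blast
    then have "T \<subseteq> fiber X f (f a)"
      using connectedin_subset_topspace[OF T(1)] unfolding fiber_def by blast
    then show ?thesis using T by blast
  qed
  then have "\<Union>?\<T> = fiber X f (f a)" by blast
  moreover have "connectedin X (\<Union>?\<T>)"
    by (rule connectedin_Union) auto
  ultimately show ?thesis by simp
qed

text \<open>If \<open>rho\<close> equals the distance of values, a chart domain maps onto a full
  ball of \<open>M\<close>, so openness relative to its image is openness in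
  \<open>M\<close>.\<close>

lemma open_map_if_isometric:
  assumes iso: "\<And>a b. \<lbrakk>a \<in> topspace X; b \<in> topspace X\<rbrakk> \<Longrightarrow> rho a b = d (f a) (f b)"
  shows "open_map X mtopology f"
  unfolding open_map_def
proof (intro allI impI)
  fix U assume U: "openin X U"
  show "openin mtopology (f ` U)"
  proof (subst openin_subopen, rule ballI)
    fix y assume "y \<in> f ` U"
    then obtain x where x: "x \<in> U" "y = f x" by blast
    have xX: "x \<in> topspace X" using x U openin_subset by blast
    obtain r G where G: "chart x r G" using chart_exists[OF xX] by blast
    have "f ` G = mball (f x) r"
    proof
      show "f ` G \<subseteq> mball (f x) r" using chartD(4)[OF G] xX by (auto simp: pre_def)
      show "mball (f x) r \<subseteq> f ` G"
      proof
        fix z assume z: "z \<in> mball (f x) r"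
        then have "z \<in> f ` topspace X" using onto by simp
        then obtain w where w: "w \<in> topspace X" "z = f w" by blast
        then have "w \<in> G" using rho_less_in_chart[OF G w(1)] iso[OF xX w(1)] z by simp
        then show "z \<in> f ` G" using w by blast
      qed
    qed
    moreover have "openin (subtopology mtopology (f ` G)) (f ` (U \<inter> G))"
      using U chartD(3)[OF G] by (intro chartD(7)[OF G]) auto
    ultimately have "openin mtopology (f ` (U \<inter> G))"
      using openin_trans_full openin_mball by metis
    then show "\<exists>T. openin mtopology T \<and> y \<in> T \<and> T \<subseteq> f ` U"
      using x chartD(1)[OF G] by (intro exI[of _ "f ` (U \<inter> G)"]) auto
  qed
qed

end

section \<open>Finite extended metrics and locally isometric curves\<close>

text \<open>The value outside \<open>Z\<close> is there because the locale \<open>Metric_space\<close> demands symmetry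
  everywhere.\<close>

definition fin_dist :: "'b set \<Rightarrow> ('b \<Rightarrow> 'b \<Rightarrow> ennreal) \<Rightarrow> 'b \<Rightarrow> 'b \<Rightarrow> real" where
  "fin_dist Z d x y = (if x \<in> Z \<and> y \<in> Z then enn2real (d x y) else 0)"

lemma ext_metric_subset: "ext_metric Y d \<Longrightarrow> Z \<subseteq> Y \<Longrightarrow> ext_metric Z d"
  unfolding ext_metric_def by (simp add: subset_iff)

text \<open>The radius may be infinite, which gives the set of points at finite distance from
  \<open>x\<close>.\<close>

lemma openin_ext_ball:
  assumes "ext_metric Y d" and x: "x \<in> Y"
  shows "openin (ext_mtopology Y d) {y \<in> Y. d x y < r}"
  unfolding openin_ext_mtopology
proof (intro conjI ballI)
  fix y assume y: "y \<in> {y \<in> Y. d x y < r}"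
  then have yr: "d x y < r" "y \<in> Y" by auto
  have "z \<in> {y \<in> Y. d x y < r}" if z: "z \<in> Y" "d y z < r - d x y" for z
  proof -
    have "d x z \<le> d x y + d y z"
      using ext_metric.triangle[OF assms(1) x yr(2) z(1)] .
    also have "\<dots> < d x y + (r - d x y)"
      using z yr less_le_trans[OF yr(1) top_greatest]
      by (simp add: ennreal_add_left_cancel_less less_top[symmetric])
    also have "\<dots> = r" using yr by (simp add: add_diff_inverse_ennreal)
    finally show ?thesis using z by simp
  qed
  then show "\<exists>s>0. {z \<in> Y. d y z < s} \<subseteq> {y \<in> Y. d x y < r}"
    using yr by (intro exI[of _ "r - d x y"]) (auto simp: diff_gr0_ennreal)
qed auto

lemma ext_mtopology_subset:
  assumes Y: "ext_metric Y d" and Z: "Z \<subseteq> Y"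
  shows "ext_mtopology Z d = subtopology (ext_mtopology Y d) Z"
  unfolding topology_eq
proof (intro allI iffI)
  fix S assume S: "openin (ext_mtopology Z d) S"
  define T where "T = \<Union>{B. openin (ext_mtopology Y d) B \<and> B \<inter> Z \<subseteq> S}"
  have "S \<subseteq> T"
  proof
    fix x assume x: "x \<in> S"
    then obtain r where r: "r > 0" "{y \<in> Z. d x y < r} \<subseteq> S" and xZ: "x \<in> Z"
      using S unfolding openin_ext_mtopology by blast
    have "d x x = 0" using ext_metric.zero[OF Y] xZ Z by blast
    then have "x \<in> {y \<in> Y. d x y < r}" using r xZ Z by auto
    moreover have "openin (ext_mtopology Y d) {y \<in> Y. d x y < r}"
      using openin_ext_ball[OF Y] xZ Z by blast
    moreover have "{y \<in> Y. d x y < r} \<inter> Z \<subseteq> S" using r by blast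
    ultimately show "x \<in> T" unfolding T_def by blast
  qed
  moreover have "S \<subseteq> Z" using S unfolding openin_ext_mtopology by blast
  ultimately have "S = T \<inter> Z" unfolding T_def by blast
  moreover have "openin (ext_mtopology Y d) T" unfolding T_def by blast
  ultimately show "openin (subtopology (ext_mtopology Y d) Z) S"
    unfolding openin_subtopology by blast
next
  fix S assume "openin (subtopology (ext_mtopology Y d) Z) S"
  then obtain T where T: "openin (ext_mtopology Y d) T" "S = T \<inter> Z"
    unfolding openin_subtopology by blast
  show "openin (ext_mtopology Z d) S"
    unfolding openin_ext_mtopology
  proof (intro conjI ballI)
    fix x assume "x \<in> S"
    then obtain r where "r > 0" "{y \<in> Y. d x y < r} \<subseteq> T"
      using T unfolding openin_ext_mtopology by blast
    then show "\<exists>r>0. {y \<in> Z. d x y < r} \<subseteq> S" using T Z by blast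
  qed (use T in auto)
qed

locale finite_ext_metric = ext_metric Z d for Z :: "'b set" and d :: "'b \<Rightarrow> 'b \<Rightarrow> ennreal" +
  assumes finite: "\<And>x y. \<lbrakk>x \<in> Z; y \<in> Z\<rbrakk> \<Longrightarrow> d x y < \<infinity>"
begin

lemma ennreal_fin_dist: "\<lbrakk>x \<in> Z; y \<in> Z\<rbrakk> \<Longrightarrow> ennreal (fin_dist Z d x y) = d x y"
  using finite by (simp add: fin_dist_def)

lemma fin_dist_nonneg: "0 \<le> fin_dist Z d x y"
  by (simp add: fin_dist_def)

sublocale fin: Metric_space Z "fin_dist Z d"
proof
  fix x y
  show "0 \<le> fin_dist Z d x y" by (rule fin_dist_nonneg)
  show "fin_dist Z d x y = fin_dist Z d y x" using commute by (simp add: fin_dist_def)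
next
  fix x y assume xy: "x \<in> Z" "y \<in> Z"
  show "fin_dist Z d x y = 0 \<longleftrightarrow> x = y"
    using xy zero[OF xy] finite[OF xy] by (auto simp: fin_dist_def enn2real_eq_0_iff)
next
  fix x y z assume xyz: "x \<in> Z" "y \<in> Z" "z \<in> Z"
  have "ennreal (fin_dist Z d x z) \<le> ennreal (fin_dist Z d x y) + ennreal (fin_dist Z d y z)"
    using triangle[OF xyz] xyz by (simp add: ennreal_fin_dist)
  then show "fin_dist Z d x z \<le> fin_dist Z d x y + fin_dist Z d y z"
    using fin_dist_nonneg by (simp add: ennreal_plus[symmetric] del: ennreal_plus)
qed

lemma dist_less_iff:
  assumes "x \<in> Z" "y \<in> Z"
  shows "d x y < ennreal r \<longleftrightarrow> fin_dist Z d x y < r"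
  using ennreal_less_iff[OF fin_dist_nonneg, of x y r] ennreal_fin_dist[OF assms] by simp

lemma fin_mtopology: "fin.mtopology = ext_mtopology Z d"
proof -
  have "(\<exists>r>0. fin.mball x r \<subseteq> U) \<longleftrightarrow> (\<exists>r>0. {y \<in> Z. d x y < r} \<subseteq> U)" if x: "x \<in> Z" for x U
  proof -
    have ball: "fin.mball x r = {y \<in> Z. d x y < ennreal r}" for r
      using x dist_less_iff[OF x] by auto
    show ?thesis
    proof
      assume "\<exists>r>0. fin.mball x r \<subseteq> U"
      then show "\<exists>r>0. {y \<in> Z. d x y < r} \<subseteq> U"
        unfolding ball by (metis ennreal_less_zero_iff)
    next
      assume "\<exists>r>0. {y \<in> Z. d x y < r} \<subseteq> U"
      then obtain r where r: "r > 0" "{y \<in> Z. d x y < r} \<subseteq> U" by blast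
      obtain s :: real where "s > 0" "ennreal s \<le> r"
      proof (cases r)
        case (real s)
        then show ?thesis using r(1) that by auto
      next
        case top
        then show ?thesis using that[of 1] by simp
      qed
      then show "\<exists>r>0. fin.mball x r \<subseteq> U"
        unfolding ball using r(2) by (intro exI[of _ s]) (auto intro: less_le_trans)
    qed
  qed
  then show ?thesis
    unfolding topology_eq openin_ext_mtopology fin.openin_mtopology by (meson subsetD)
qed

end

section \<open>Curve length and curves of unit speed\<close>

lemma dist_le_curve_length:
  assumes "a \<le> b"
  shows "d (c a) (c b) \<le> curve_length d a b c"
  unfolding curve_length_def
  by (rule SUP_upper2[of "(1, \<lambda>i. if i = 0 then a else b)"]) (use assms in auto)

text \<open>Partition at \<open>t\<close> alone: each point of an almost shortest curve lies in a
  thin ellipse about the endpoints.\<close>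

lemma dist_add_le_curve_length:
  assumes "a \<le> t" "t \<le> b"
  shows "d (c a) (c t) + d (c t) (c b) \<le> curve_length d a b c"
  unfolding curve_length_def
  by (rule SUP_upper2[of "(2, \<lambda>i. if i = 0 then a else if i = 1 then t else b)"])
    (use assms in \<open>auto simp: numeral_2_eq_2 less_Suc_eq\<close>)

lemma curve_length_isometric:
  assumes "a \<le> b" and iso: "\<And>s t. \<lbrakk>s \<in> {a..b}; t \<in> {a..b}\<rbrakk> \<Longrightarrow> d (c s) (c t) = ennreal \<bar>s - t\<bar>"
  shows "curve_length d a b c = ennreal (b - a)"
proof (rule antisym)
  have "(\<Sum>i<n. d (c (t i)) (c (t (Suc i)))) \<le> ennreal (b - a)"
    if t: "t 0 = a" "t n = b" "\<forall>i<n. t i \<le> t (Suc i)" for n :: nat and t :: "nat \<Rightarrow> real"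
  proof -
    have mono: "t i \<le> t j" if "i \<le> j" "j \<le> n" for i j
      using that
    proof (induction rule: dec_induct)
      case (step k)
      then have "t i \<le> t k" "t k \<le> t (Suc k)" using t(3) by auto
      then show ?case by linarith
    qed simp
    have "(\<Sum>i<n. d (c (t i)) (c (t (Suc i)))) = (\<Sum>i<n. ennreal (t (Suc i) - t i))"
    proof (rule sum.cong)
      fix i assume "i \<in> {..<n}"
      then have i: "i < n" by simp
      have "t i \<in> {a..b}" "t (Suc i) \<in> {a..b}" "t i \<le> t (Suc i)"
        using mono[of 0 i] mono[of i n] mono[of 0 "Suc i"] mono[of "Suc i" n] i t by auto
      then show "d (c (t i)) (c (t (Suc i))) = ennreal (t (Suc i) - t i)"
        using iso[of "t i" "t (Suc i)"] by simp
    qed simp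
    also have "\<dots> = ennreal (\<Sum>i<n. t (Suc i) - t i)"
      using t by (intro sum_ennreal) auto
    also have "\<dots> = ennreal (b - a)"
      using sum_lessThan_telescope[of t n] t by simp
    finally show ?thesis by simp
  qed
  then show "curve_length d a b c \<le> ennreal (b - a)"
    unfolding curve_length_def by (intro SUP_least) auto
  show "ennreal (b - a) \<le> curve_length d a b c"
    using dist_le_curve_length[OF assms(1), of d c] iso[of a b] assms(1) by simp
qed

lemma continuous_map_Lipschitz:
  assumes "c ` I \<subseteq> M" and lip: "\<And>s t. \<lbrakk>s \<in> I; t \<in> I\<rbrakk> \<Longrightarrow> d (c s) (c t) \<le> ennreal \<bar>s - t\<bar>"
  shows "continuous_map (top_of_set I) (ext_mtopology M d) c"
  unfolding continuous_map_def
proof (intro conjI allI impI)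
  show "c \<in> topspace (top_of_set I) \<rightarrow> topspace (ext_mtopology M d)"
    using assms(1) by auto
  fix U assume U: "openin (ext_mtopology M d) U"
  show "openin (top_of_set I) {x \<in> topspace (top_of_set I). c x \<in> U}"
    unfolding openin_euclidean_subtopology_iff
  proof (intro conjI ballI)
    fix s assume s: "s \<in> {x \<in> topspace (top_of_set I). c x \<in> U}"
    then obtain r where r: "r > 0" "{y \<in> M. d (c s) y < r} \<subseteq> U"
      using U unfolding openin_ext_mtopology by auto
    obtain e :: real where e: "e > 0" "ennreal e \<le> r"
    proof (cases r)
      case (real s)
      then show ?thesis using r(1) that by auto
    next
      case top
      then show ?thesis using that[of 1] by simp
    qed
    have "c t \<in> U" if t: "t \<in> I" "dist t s < e" for t
    proof -
      have "d (c s) (c t) \<le> ennreal \<bar>s - t\<bar>" using lip s t by simp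
      also have "\<dots> < ennreal e" using t by (simp add: ennreal_less_iff dist_real_def)
      also note e(2)
      finally show ?thesis using r(2) t assms(1) by blast
    qed
    then show "\<exists>e>0. \<forall>x'\<in>I. dist x' s < e \<longrightarrow> x' \<in> {x \<in> topspace (top_of_set I). c x \<in> U}"
      using e by auto
  qed auto
qed

lemma shortest_path_isometric:
  assumes "a \<le> b" "continuous_map (top_of_set {a..b}) (ext_mtopology M d) c"
    and iso: "\<And>s t. \<lbrakk>s \<in> {a..b}; t \<in> {a..b}\<rbrakk> \<Longrightarrow> d (c s) (c t) = ennreal \<bar>s - t\<bar>"
  shows "shortest_path M d a b c"
  unfolding shortest_path_def
proof (intro conjI allI impI)
  show "curve M d a b c" using assms by (simp add: curve_def)
  fix a' b' c' assume c': "curve M d a' b' c' \<and> c' a' = c a \<and> c' b' = c b"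
  have "curve_length d a b c = d (c a) (c b)"
    using curve_length_isometric[OF assms(1), of d c] iso assms(1) by simp
  also have "\<dots> \<le> curve_length d a' b' c'"
    using dist_le_curve_length[of a' b' d c'] c' unfolding curve_def by auto
  finally show "curve_length d a b c \<le> curve_length d a' b' c'" .
qed

text \<open>Unit speed near each parameter makes short pieces attain the distance of their
  endpoints, so they are shortest; it also excludes pauses.\<close>

lemma geodesic_locally_isometric:
  assumes cM: "c ` {0..L} \<subseteq> M"
    and lip: "\<And>s t. \<lbrakk>s \<in> {0..L}; t \<in> {0..L}\<rbrakk> \<Longrightarrow> d (c s) (c t) \<le> ennreal \<bar>s - t\<bar>"
    and loc: "\<And>t. t \<in> {0..L} \<Longrightarrow> \<exists>e>0. \<forall>s\<in>{0..L}. \<forall>s'\<in>{0..L}. \<bar>s - t\<bar> < e \<longrightarrow> \<bar>s' - t\<bar> < e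
        \<longrightarrow> d (c s) (c s') = ennreal \<bar>s - s'\<bar>"
  shows "geodesic M d {0..L} c"
  unfolding geodesic_def
proof (intro conjI ballI impI)
  show "is_interval {0..L}" by (simp add: is_interval_cc)
  show cont: "continuous_map (top_of_set {0..L}) (ext_mtopology M d) c"
    using cM lip by (rule continuous_map_Lipschitz)
  fix t assume t: "t \<in> {0..L}"
  obtain e where e: "e > 0" and iso: "\<And>s s'. \<lbrakk>s \<in> {0..L}; s' \<in> {0..L}; \<bar>s - t\<bar> < e; \<bar>s' - t\<bar> < e\<rbrakk>
      \<Longrightarrow> d (c s) (c s') = ennreal \<bar>s - s'\<bar>"
    using loc[OF t] by blast
  \<comment> \<open>Halving \<open>e\<close> keeps the closed interval strictly inside the window of
    isometry; \<open>max\<close> and \<open>min\<close> clip it to the domain.\<close>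
  define u v where "u = max 0 (t - e/2)" and "v = min L (t + e/2)"
  have uv: "u \<le> v" "{u..v} \<subseteq> {0..L}" "{0..L} \<inter> {t - e/2<..<t + e/2} \<subseteq> {u..v}"
    using t e by (auto simp: u_def v_def)
  have "shortest_path M d u v c"
  proof (rule shortest_path_isometric[OF uv(1)])
    show "continuous_map (top_of_set {u..v}) (ext_mtopology M d) c"
      using cont uv(2) by (rule continuous_map_from_subtopology_mono)
    fix s s' assume "s \<in> {u..v}" "s' \<in> {u..v}"
    then show "d (c s) (c s') = ennreal \<bar>s - s'\<bar>"
      using uv(2) e by (intro iso) (auto simp: u_def v_def abs_less_iff)
  qed
  then show "\<exists>u v. {u..v} \<subseteq> {0..L} \<and> (\<exists>e>0. {0..L} \<inter> {t - e<..<t + e} \<subseteq> {u..v}) \<and> shortest_path M d u v c"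
    using uv e by (intro exI[of _ u] exI[of _ v] conjI exI[of _ "e/2"]) auto
next
  fix u v assume u: "u \<in> {0..L}" and v: "v \<in> {0..L}" and "u < v"
  obtain e where e: "e > 0" and iso: "\<And>s s'. \<lbrakk>s \<in> {0..L}; s' \<in> {0..L}; \<bar>s - u\<bar> < e; \<bar>s' - u\<bar> < e\<rbrakk>
      \<Longrightarrow> d (c s) (c s') = ennreal \<bar>s - s'\<bar>"
    using loc[OF u] by blast
  define w where "w = min v (u + e/2)"
  have w: "u < w" "w \<le> v" "\<bar>w - u\<bar> < e" using \<open>u < v\<close> e by (auto simp: w_def)
  have wL: "w \<in> {0..L}" using u v w by auto
  show "\<not> c constant_on {u..v}"
  proof
    assume "c constant_on {u..v}"
    then have "c u = c w" unfolding constant_on_def using w \<open>u < v\<close> by auto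
    moreover have "d (c u) (c w) = ennreal \<bar>u - w\<bar>" using iso[OF u wL] e w by simp
    moreover have "d (c w) (c w) = ennreal \<bar>w - w\<bar>" using iso[OF wL wL] e w by simp
    ultimately show False using w by simp
  qed
qed

text \<open>Both curves preserve small parameter distances, so the increasing map \<open>p\<close>
  does too; thus \<open>p t - t\<close> is locally constant, hence constant on the interval, and its
  values at the two ends can be compared.\<close>

lemma reparametrization_locally_isometric:
  assumes "0 \<le> L" "0 \<le> D" and rep: "reparametrization 0 L c 0 D c'"
    and iso: "\<And>s t. \<lbrakk>s \<in> {0..D}; t \<in> {0..D}\<rbrakk> \<Longrightarrow> d (c' s) (c' t) = ennreal \<bar>s - t\<bar>"
    and loc: "\<And>t. t \<in> {0..L} \<Longrightarrow> \<exists>e>0. \<forall>s\<in>{0..L}. \<forall>s'\<in>{0..L}. \<bar>s - t\<bar> < e \<longrightarrow> \<bar>s' - t\<bar> < e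
        \<longrightarrow> d (c s) (c s') = ennreal \<bar>s - s'\<bar>"
  shows "L = D"
proof -
  obtain p where p: "strict_mono_on {0..L} p" "p ` {0..L} = {0..D}" "\<And>t. t \<in> {0..L} \<Longrightarrow> c t = c' (p t)"
    using rep unfolding reparametrization_def by blast
  have mono: "p s \<le> p t" if "s \<in> {0..L}" "t \<in> {0..L}" "s \<le> t" for s t
    using p(1) that by (simp add: strict_mono_on_leD)
  have in_D: "p t \<in> {0..D}" if "t \<in> {0..L}" for t using p(2) that by blast
  have p0: "p 0 = 0"
  proof -
    obtain z where "z \<in> {0..L}" "p z = 0" using p(2) \<open>0 \<le> D\<close> by (metis atLeastAtMost_iff imageE order_refl)
    then show ?thesis using mono[of 0 z] in_D[of 0] \<open>0 \<le> L\<close> by auto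
  qed
  have pL: "p L = D"
  proof -
    obtain z where "z \<in> {0..L}" "p z = D" using p(2) \<open>0 \<le> D\<close> by (metis atLeastAtMost_iff imageE order_refl)
    then show ?thesis using mono[of z L] in_D[of L] \<open>0 \<le> L\<close> by auto
  qed
  have "p 0 - 0 = p L - L"
  proof (rule connected_local_const[where A = "{0..L}" and f = "\<lambda>t. p t - t"])
    show "\<forall>t\<in>{0..L}. \<forall>\<^sub>F s in at t within {0..L}. p t - t = p s - s"
    proof
      fix t assume t: "t \<in> {0..L}"
      obtain e where e: "e > 0" and c: "\<And>s s'. \<lbrakk>s \<in> {0..L}; s' \<in> {0..L}; \<bar>s - t\<bar> < e; \<bar>s' - t\<bar> < e\<rbrakk>
          \<Longrightarrow> d (c s) (c s') = ennreal \<bar>s - s'\<bar>"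
        using loc[OF t] by blast
      have "p t - t = p s - s" if s: "s \<in> {0..L}" "dist s t < e" for s
      proof -
        have "ennreal \<bar>p s - p t\<bar> = d (c s) (c t)"
          using iso[OF in_D[OF s(1)] in_D[OF t]] p(3)[OF s(1)] p(3)[OF t] by simp
        also have "\<dots> = ennreal \<bar>s - t\<bar>"
          using c[OF s(1) t] s e by (simp add: dist_real_def)
        finally have "\<bar>p s - p t\<bar> = \<bar>s - t\<bar>" by simp
        then show ?thesis using mono[OF s(1) t] mono[OF t s(1)] by linarith
      qed
      then show "\<forall>\<^sub>F s in at t within {0..L}. p t - t = p s - s"
        unfolding eventually_at using e by blast
    qed
  qed (use \<open>0 \<le> L\<close> in auto)
  then show ?thesis using p0 pL by simp
qed

text \<open>The connected set is the image of a curve whose length exceeds \<open>d x y\<close> by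
  less than \<open>e\<close>. Such a curve exists because \<open>d x y\<close> is finite, so that
  adding \<open>e\<close> makes it strictly larger.\<close>

lemma length_metric_almost_convex:
  assumes "finite_ext_metric Z d" "C \<subseteq> Z" and len: "length_metric C d"
  shows "Metric_space.almost_convex Z (fin_dist Z d) C"
proof -
  interpret finite_ext_metric Z d by fact
  show ?thesis
    unfolding fin.almost_convex_def
  proof (intro conjI ballI allI impI)
    show "C \<subseteq> Z" by fact
    fix x y and e :: real assume x: "x \<in> C" and y: "y \<in> C" and "e > 0"
    have xZ: "x \<in> Z" and yZ: "y \<in> Z" using x y assms(2) by auto
    have "d x y < d x y + ennreal e"
      using ennreal_add_left_cancel_less[of "d x y" 0 "ennreal e"] finite[OF xZ yZ] \<open>e > 0\<close> by auto
    moreover have "d x y = (INF (a, b, c) \<in> {(a, b, c). curve C d a b c \<and> c a = x \<and> c b = y \<and> curve_length d a b c < \<infinity>}.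
           curve_length d a b c)"
      using len x y unfolding length_metric_def by blast
    ultimately have "(INF (a, b, c) \<in> {(a, b, c). curve C d a b c \<and> c a = x \<and> c b = y \<and> curve_length d a b c < \<infinity>}.
           curve_length d a b c) < d x y + ennreal e"
      by simp
    then obtain a b c where c: "curve C d a b c" "c a = x" "c b = y" "curve_length d a b c < d x y + ennreal e"
      unfolding INF_less_iff by auto
    let ?K = "c ` {a..b}"
    have ab: "a \<le> b" and cont: "continuous_map (top_of_set {a..b}) (ext_mtopology C d) c"
      using c(1) by (auto simp: curve_def)
    have "connectedin (ext_mtopology C d) ?K"
      by (rule connectedin_continuous_map_image[OF cont]) (simp add: connectedin_subtopology)
    then have K: "connectedin fin.mtopology ?K" "?K \<subseteq> C"
      unfolding fin_mtopology ext_mtopology_subset[OF ext_metric_axioms assms(2)] connectedin_subtopology by auto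
    have "fin_dist Z d x u + fin_dist Z d u y < fin_dist Z d x y + e" if u: "u \<in> ?K" for u
    proof -
      obtain t where t: "t \<in> {a..b}" "u = c t" using u by blast
      have uZ: "u \<in> Z" using K(2) u assms(2) by blast
      have "d x u + d u y \<le> curve_length d a b c"
        using dist_add_le_curve_length[of a t b d c] t c(2,3) by auto
      then have "d x u + d u y < d x y + ennreal e" using c(4) by simp
      then have "ennreal (fin_dist Z d x u + fin_dist Z d u y) < ennreal (fin_dist Z d x y + e)"
        using ennreal_fin_dist[OF xZ uZ] ennreal_fin_dist[OF uZ yZ] ennreal_fin_dist[OF xZ yZ] \<open>e > 0\<close>
        by (simp add: ennreal_plus[OF fin_dist_nonneg])
      then show ?thesis
        using fin_dist_nonneg by (simp add: ennreal_less_iff del: ennreal_plus)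
    qed
    then show "\<exists>K. connectedin fin.mtopology K \<and> K \<subseteq> C \<and> x \<in> K \<and> y \<in> K \<and>
        (\<forall>u\<in>K. fin_dist Z d x u + fin_dist Z d u y < fin_dist Z d x y + e)"
      using K c(2,3) ab by (intro exI[of _ ?K]) auto
  qed
qed

lemma ext_mcomplete_finite:
  assumes "ext_metric Y d" "ext_mcomplete Y d" and fin: "finite_ext_metric Z d" and Z: "closedin (ext_mtopology Y d) Z"
  shows "Metric_space.mcomplete Z (fin_dist Z d)"
proof -
  interpret finite_ext_metric Z d by fact
  have ZY: "Z \<subseteq> Y" using closedin_subset[OF Z] by simp
  show ?thesis
    unfolding fin.mcomplete_def
  proof (intro allI impI)
    fix s assume s: "fin.MCauchy s"
    then have sZ: "range s \<subseteq> Z" unfolding fin.MCauchy_def by blast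
    have "\<exists>N. \<forall>m\<ge>N. \<forall>n\<ge>N. d (s m) (s n) < e" if "e > 0" for e
    proof -
      obtain r :: real where r: "r > 0" "ennreal r \<le> e"
      proof (cases e)
        case (real r)
        then show ?thesis using \<open>e > 0\<close> that by auto
      next
        case top
        then show ?thesis using that[of 1] by simp
      qed
      obtain N where N: "\<And>m n. m \<ge> N \<Longrightarrow> n \<ge> N \<Longrightarrow> fin_dist Z d (s m) (s n) < r"
        using s r(1) unfolding fin.MCauchy_def by meson
      have "d (s m) (s n) < e" if "m \<ge> N" "n \<ge> N" for m n
        using dist_less_iff[of "s m" "s n" r] N[OF that] sZ r(2) by (auto intro: less_le_trans)
      then show ?thesis by blast
    qed
    moreover have "range s \<subseteq> Y" using sZ ZY by blast
    ultimately obtain l where l: "limitin (ext_mtopology Y d) s l sequentially"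
      using assms(2) unfolding ext_mcomplete_def by blast
    have "l \<in> Z" using sZ by (intro limitin_closedin[OF l Z] always_eventually) auto
    then have "limitin fin.mtopology s l sequentially"
      unfolding fin_mtopology ext_mtopology_subset[OF assms(1) ZY] limitin_subtopology
      using l sZ \<open>l \<in> Z\<close> by (intro conjI always_eventually) auto
    then show "\<exists>x. limitin fin.mtopology s x sequentially" by blast
  qed
qed

text \<open>Finite distance is an equivalence relation whose classes are open balls of infinite
  radius, so a connected set lies in one class.\<close>

lemma connectedin_finite_dist:
  assumes Y: "ext_metric Y d" and S: "connectedin (ext_mtopology Y d) S" and x: "x \<in> S" and y: "y \<in> S"
  shows "d x y < \<infinity>"
proof (rule ccontr)
  assume n: "\<not> d x y < \<infinity>"
  have SY: "S \<subseteq> Y" using connectedin_subset_topspace[OF S] by simp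
  let ?A = "{z \<in> Y. d x z < \<infinity>}" and ?B = "{z \<in> Y. \<not> d x z < \<infinity>}"
  have "openin (ext_mtopology Y d) ?A"
    using openin_ext_ball[OF Y] x SY by blast
  moreover have "openin (ext_mtopology Y d) ?B"
    unfolding openin_ext_mtopology
  proof (intro conjI ballI)
    fix z assume z: "z \<in> ?B"
    have "w \<in> ?B" if w: "w \<in> Y" "d z w < \<infinity>" for w
    proof -
      have "d x z \<le> d x w + d w z" "d w z = d z w"
        using ext_metric.triangle[OF Y, of x w z] ext_metric.commute[OF Y, of w z] x SY z w by blast+
      then have "\<not> d x w < \<infinity>" using z w(2)
        by (metis (no_types, lifting) ennreal_add_less_top infinity_ennreal_def leD mem_Collect_eq not_less order.strict_trans1)
      then show ?thesis using w by simp
    qed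
    then show "\<exists>r>0. {w \<in> Y. d z w < r} \<subseteq> ?B" by (intro exI[of _ "\<infinity>"]) auto
  qed auto
  moreover have "x \<in> ?A \<inter> S" "y \<in> ?B \<inter> S"
    using x y n SY ext_metric.zero[OF Y, of x x] by (simp_all add: subset_iff)
  moreover have "S \<subseteq> ?A \<union> ?B" "?A \<inter> ?B \<inter> S = {}" using SY by auto
  ultimately show False using S unfolding connectedin by blast
qed

section \<open>The local-to-global principle\<close>

theorem theorem2p15:
  fixes X :: "'a topology" and Y :: "'b set" and d :: "'b \<Rightarrow> 'b \<Rightarrow> ennreal" and f :: "'a \<Rightarrow> 'b"
  assumes "normal_space X" and "first_countable X" and "path_connected_space X"
    and "Hausdorff_space X"
    and "length_space Y d" and "ext_mcomplete Y d"
    and "locally_compact_space (ext_mtopology Y d)"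
    and "continuous_map X (ext_mtopology Y d) f"
    and "closed_map X (ext_mtopology Y d) f"
    and "locally_open_onto_image X (ext_mtopology Y d) f"
    and "locally_fiber_connected X f"
    and "local_convexity_data X Y d f"
  shows "weakly_convex Y d (f ` topspace X) \<and>
    (uniquely_geodesic Y d \<and> (\<forall>y1\<in>Y. \<forall>y2\<in>Y. d y1 y2 < \<infinity>) \<longrightarrow>
       metric_convex Y d (f ` topspace X) \<and>
       (\<forall>y\<in>f ` topspace X. connectedin X (fiber X f y)) \<and>
       open_map X (subtopology (ext_mtopology Y d) (f ` topspace X)) f)"
proof -
  let ?T = "ext_mtopology Y d"
  define Z where "Z = f ` topspace X"
  have Y: "ext_metric Y d" and len: "length_metric Y d"
    using assms(5) by (auto simp: length_space_def)
  have conn: "connected_space X" using assms(3) by (rule path_connected_imp_connected_space)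
  \<comment> \<open>The image of a closed map is closed, so \<open>Z\<close> inherits completeness
    and local compactness from \<open>Y\<close>.\<close>
  have Zclosed: "closedin ?T Z"
    using assms(9) closedin_topspace unfolding closed_map_def Z_def by blast
  then have ZY: "Z \<subseteq> Y" using closedin_subset by fastforce
  have "connectedin ?T Z"
    unfolding Z_def using conn by (intro connectedin_continuous_map_image[OF assms(8)])
      (simp add: connectedin_topspace)
  then interpret Z: finite_ext_metric Z d
    unfolding finite_ext_metric_def finite_ext_metric_axioms_def
    using ext_metric_subset[OF Y ZY] connectedin_finite_dist[OF Y] by blast
  have top: "Z.fin.mtopology = subtopology ?T Z"
    unfolding Z.fin_mtopology by (rule ext_mtopology_subset[OF Y ZY])
  interpret lg: local_global Z "fin_dist Z d" X f
  proof (unfold_locales)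
    show "normal_space X" "Hausdorff_space X" "connected_space X" by fact+
    show "continuous_map X Z.fin.mtopology f"
      unfolding top continuous_map_in_subtopology using assms(8) by (auto simp: Z_def)
    show "closed_map X Z.fin.mtopology f"
      unfolding top by (intro closed_map_into_subtopology assms(9)) (auto simp: Z_def)
    show "f ` topspace X = Z" by (simp add: Z_def)
    show "Z.fin.mcomplete"
      using ext_mcomplete_finite[OF Y assms(6) Z.finite_ext_metric_axioms Zclosed] .
    show "locally_compact_space Z.fin.mtopology"
      unfolding top by (rule locally_compact_space_closed_subset[OF assms(7) Zclosed])
    show "locally_open_onto_image X Z.fin.mtopology f"
      unfolding locally_open_onto_image_def
    proof
      fix x assume "x \<in> topspace X"
      then obtain U where U: "openin X U" "x \<in> U" "open_map (subtopology X U) (subtopology ?T (f ` U)) f"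
        using assms(10) unfolding locally_open_onto_image_def by blast
      have "Z \<inter> f ` U = f ` U" using openin_subset[OF U(1)] unfolding Z_def by blast
      then have "subtopology Z.fin.mtopology (f ` U) = subtopology ?T (f ` U)"
        unfolding top subtopology_subtopology by simp
      then show "\<exists>U. openin X U \<and> x \<in> U \<and> open_map (subtopology X U) (subtopology Z.fin.mtopology (f ` U)) f"
        using U by metis
    qed
    show "locally_fiber_connected X f" by fact
    show "neighbourhood_base_of (\<lambda>U. Z.fin.almost_convex (f ` U)) X"
      unfolding neighbourhood_base_of
    proof (intro allI impI)
      fix W x assume W: "openin X W \<and> x \<in> W"
      then obtain U V where UV: "openin X U" "metric_convex Y d (f ` V)" "x \<in> U" "U \<subseteq> V" "V \<subseteq> W"
        using assms(12) unfolding local_convexity_data_def neighbourhood_base_of by meson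
      have "f ` V \<subseteq> Z" using UV(5) W openin_subset unfolding Z_def by blast
      then have "Z.fin.almost_convex (f ` V)"
        using length_metric_almost_convex[OF Z.finite_ext_metric_axioms] UV(2) unfolding metric_convex_def by blast
      then show "\<exists>U V. openin X U \<and> Z.fin.almost_convex (f ` V) \<and> x \<in> U \<and> U \<subseteq> V \<and> V \<subseteq> W"
        using UV by blast
    qed
  qed
  \<comment> \<open>The local isometry is recorded besides \<open>geodesic\<close>, which does not
    fix the parametrization; comparing parameter lengths later needs unit speed.\<close>
  have geod: "\<exists>c. c ` {0..lg.rho x y} \<subseteq> Z \<and> c 0 = f x \<and> c (lg.rho x y) = f y \<and>
      geodesic Y d {0..lg.rho x y} c \<and>
      (\<forall>t\<in>{0..lg.rho x y}. \<exists>e>0. \<forall>s\<in>{0..lg.rho x y}. \<forall>s'\<in>{0..lg.rho x y}.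
         \<bar>s - t\<bar> < e \<longrightarrow> \<bar>s' - t\<bar> < e \<longrightarrow> d (c s) (c s') = ennreal \<bar>s - s'\<bar>)"
    if xy: "x \<in> topspace X" "y \<in> topspace X" for x y
  proof -
    let ?I = "{0..lg.rho x y}"
    obtain c where c: "c ` ?I \<subseteq> Z" "c 0 = f x" "c (lg.rho x y) = f y"
      and lip: "\<forall>s\<in>?I. \<forall>t\<in>?I. fin_dist Z d (c s) (c t) \<le> \<bar>s - t\<bar>"
      and loc: "\<forall>t\<in>?I. \<exists>e>0. \<forall>s\<in>?I. \<forall>s'\<in>?I. \<bar>s - t\<bar> < e \<longrightarrow> \<bar>s' - t\<bar> < e
        \<longrightarrow> fin_dist Z d (c s) (c s') = \<bar>s - s'\<bar>"
      using lg.projected_rho_geodesic[OF xy] by blast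
    have cd: "d (c s) (c t) = ennreal (fin_dist Z d (c s) (c t))" if "s \<in> ?I" "t \<in> ?I" for s t
      using Z.ennreal_fin_dist[of "c s" "c t"] c(1) that by (simp add: image_subset_iff)
    have loc': "\<exists>e>0. \<forall>s\<in>?I. \<forall>s'\<in>?I. \<bar>s - t\<bar> < e \<longrightarrow> \<bar>s' - t\<bar> < e
        \<longrightarrow> d (c s) (c s') = ennreal \<bar>s - s'\<bar>" if "t \<in> ?I" for t
    proof -
      obtain e where e: "e > 0" "\<forall>s\<in>?I. \<forall>s'\<in>?I. \<bar>s - t\<bar> < e \<longrightarrow> \<bar>s' - t\<bar> < e
        \<longrightarrow> fin_dist Z d (c s) (c s') = \<bar>s - s'\<bar>"
        using bspec[OF loc \<open>t \<in> ?I\<close>] by blast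
      then show ?thesis using cd by (intro exI[of _ e]) simp
    qed
    \<comment> \<open>Short pieces realize the distance \<open>d\<close> of their endpoints, so they
      are shortest among all curves of \<open>Y\<close> and not only among those in
      \<open>Z\<close>.\<close>
    have "geodesic Y d ?I c"
    proof (rule geodesic_locally_isometric)
      show "c ` ?I \<subseteq> Y" using c(1) ZY by blast
      show "d (c s) (c t) \<le> ennreal \<bar>s - t\<bar>" if "s \<in> ?I" "t \<in> ?I" for s t
        unfolding cd[OF that] using lip that by (intro ennreal_leI) blast
    qed (rule loc')
    then show ?thesis using c loc' by blast
  qed
  have "weakly_convex Y d Z"
    unfolding weakly_convex_def geodesic_joining_def
  proof (intro conjI ballI ZY)
    fix y y' assume "y \<in> Z" "y' \<in> Z"
    then obtain x x' where x: "x \<in> topspace X" "x' \<in> topspace X" "y = f x" "y' = f x'"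
      unfolding Z_def by blast
    show "\<exists>a b c. (a \<le> b \<and> geodesic Y d {a..b} c \<and> c a = y \<and> c b = y') \<and> c ` {a..b} \<subseteq> Z"
      using geod[OF x(1,2)] x(3,4) lg.rho.nonneg[OF x(1,2)] by blast
  qed
  moreover have "metric_convex Y d Z \<and> (\<forall>y\<in>Z. connectedin X (fiber X f y)) \<and>
      open_map X (subtopology ?T Z) f"
    if uniq: "uniquely_geodesic Y d" and finite: "\<forall>y1\<in>Y. \<forall>y2\<in>Y. d y1 y2 < \<infinity>"
  proof -
    interpret Y: finite_ext_metric Y d
      unfolding finite_ext_metric_def finite_ext_metric_axioms_def using Y finite by blast
    have Ytop: "Y.fin.mtopology = ?T" by (rule Y.fin_mtopology)
    have iso: "lg.rho a b = fin_dist Z d (f a) (f b)"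
      if ab: "a \<in> topspace X" "b \<in> topspace X" for a b
    proof -
      let ?D = "fin_dist Y d (f a) (f b)"
      have fab: "f a \<in> Z" "f b \<in> Z" "f a \<in> Y" "f b \<in> Y" using ab ZY by (auto simp: Z_def)
      have DZ: "?D = fin_dist Z d (f a) (f b)" using fab by (simp add: fin_dist_def)
      have "Y.fin.mcomplete"
        using ext_mcomplete_finite[OF Y assms(6) Y.finite_ext_metric_axioms] closedin_topspace[of ?T] by simp
      moreover have "locally_compact_space Y.fin.mtopology" using assms(7) Ytop by simp
      moreover have "Y.fin.almost_convex Y"
        by (rule length_metric_almost_convex[OF Y.finite_ext_metric_axioms order_refl len])
      ultimately obtain c' where c': "c' ` {0..?D} \<subseteq> Y" "c' 0 = f a" "c' ?D = f b"
        "\<And>s t. \<lbrakk>s \<in> {0..?D}; t \<in> {0..?D}\<rbrakk> \<Longrightarrow> fin_dist Y d (c' s) (c' t) = \<bar>s - t\<bar>"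
        using Y.fin.Metric_Hopf_Rinow[OF _ _ _ fab(3,4)] by blast
      have c'iso: "d (c' s) (c' t) = ennreal \<bar>s - t\<bar>" if "s \<in> {0..?D}" "t \<in> {0..?D}" for s t
        using Y.ennreal_fin_dist[of "c' s" "c' t"] c'(1) c'(4)[OF that] that by (simp add: image_subset_iff)
      have D0: "0 \<le> ?D" by (rule Y.fin_dist_nonneg)
      have "geodesic Y d {0..?D} c'"
        by (rule geodesic_locally_isometric[OF c'(1)]) (use c'iso in \<open>auto intro: exI[of _ 1]\<close>)
      then have g': "geodesic_joining Y d (f a) (f b) 0 ?D c'"
        using c' D0 by (simp add: geodesic_joining_def)
      obtain c where c: "c 0 = f a" "c (lg.rho a b) = f b" "geodesic Y d {0..lg.rho a b} c"
        and loc: "\<forall>t\<in>{0..lg.rho a b}. \<exists>e>0. \<forall>s\<in>{0..lg.rho a b}. \<forall>s'\<in>{0..lg.rho a b}.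
         \<bar>s - t\<bar> < e \<longrightarrow> \<bar>s' - t\<bar> < e \<longrightarrow> d (c s) (c s') = ennreal \<bar>s - s'\<bar>"
        using geod[OF ab] by blast
      have rho0: "0 \<le> lg.rho a b" using lg.rho.nonneg ab .
      then have "geodesic_joining Y d (f a) (f b) 0 (lg.rho a b) c"
        using c by (simp add: geodesic_joining_def)
      \<comment> \<open>Uniqueness enters here. It gives only some reparametrization; equality of
        the parameter lengths then follows from unit speed.\<close>
      then have rep: "reparametrization 0 (lg.rho a b) c 0 ?D c'"
        using uniq g' fab(3,4) unfolding uniquely_geodesic_def by blast
      have "lg.rho a b = ?D"
      proof (rule reparametrization_locally_isometric[OF rho0 D0 rep, where d = d])
        show "d (c' s) (c' t) = ennreal \<bar>s - t\<bar>" if "s \<in> {0..?D}" "t \<in> {0..?D}" for s t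
          using that by (rule c'iso)
      qed (rule bspec[OF loc])
      then show ?thesis using DZ by simp
    qed
    have "length_metric Z d"
      unfolding length_metric_def
    proof (intro ballI antisym)
      fix y y' assume y: "y \<in> Z" "y' \<in> Z"
      show "d y y' \<le> (INF (a, b, c) \<in> {(a, b, c). curve Z d a b c \<and> c a = y \<and> c b = y' \<and> curve_length d a b c < \<infinity>}.
           curve_length d a b c)"
        by (intro INF_greatest) (auto simp: curve_def intro: dist_le_curve_length)
      obtain a b where ab: "a \<in> topspace X" "b \<in> topspace X" "y = f a" "y' = f b"
        using y unfolding Z_def by blast
      let ?I = "{0..lg.rho a b}"
      \<comment> \<open>With \<open>rho\<close> equal to the distance of values, the projected path
        is isometric and stays in \<open>Z\<close>, so it attains the infimum.\<close>
      obtain c where c: "c ` ?I \<subseteq> Z" "c 0 = f a" "c (lg.rho a b) = f b"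
        and ciso: "\<forall>s\<in>?I. \<forall>t\<in>?I. fin_dist Z d (c s) (c t) = \<bar>s - t\<bar>"
        using lg.projected_rho_geodesic_isometric[OF ab(1,2) iso] by blast
      have ciso': "d (c s) (c t) = ennreal \<bar>s - t\<bar>" if "s \<in> ?I" "t \<in> ?I" for s t
        using Z.ennreal_fin_dist[of "c s" "c t"] c(1) ciso that by (simp add: image_subset_iff)
      have rho0: "0 \<le> lg.rho a b" using lg.rho.nonneg ab(1,2) .
      have "curve Z d 0 (lg.rho a b) c"
        unfolding curve_def using rho0 continuous_map_Lipschitz[OF c(1), of d] ciso' by simp
      moreover have "curve_length d 0 (lg.rho a b) c = d y y'"
        using curve_length_isometric[OF rho0, of d c, OF ciso'] iso[OF ab(1,2)] Z.ennreal_fin_dist[OF y] ab(3,4) by simp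
      ultimately show "(INF (a, b, c) \<in> {(a, b, c). curve Z d a b c \<and> c a = y \<and> c b = y' \<and> curve_length d a b c < \<infinity>}.
           curve_length d a b c) \<le> d y y'"
        using c(2,3) ab(3,4) Z.finite[OF y] by (intro INF_lower2[of "(0, lg.rho a b, c)"]) auto
    qed
    then have "metric_convex Y d Z"
      unfolding metric_convex_def using ZY Z.finite by blast
    moreover have "connectedin X (fiber X f y)" if "y \<in> Z" for y
      using that lg.connected_fiber_if_isometric[OF iso] unfolding Z_def by blast
    moreover have "open_map X (subtopology ?T Z) f"
      using lg.open_map_if_isometric[OF iso] unfolding top .
    ultimately show ?thesis by blast
  qed
  ultimately show ?thesis unfolding Z_def by blast
qed

end
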